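(* Let $n\ge 3$, $d\ge 3$, and let $f\in S_d$ be a homogeneous polynomial of degree $d$ in $S=\mathbb{C}[x_1,\ldots,x_n]$ such that the projective hypersurface $f=0$ in $\mathbb{P}^{n-1}$ is smooth. Put $T=n(d-2)$, let $J(f)=(\partial f/\partial x_1,\ldots,\partial f/\partial x_n)$ be the Jacobian ideal and $M(f)=S/J(f)$ the Milnor algebra. Assume that $J(f)$ satisfies the following two conditions, which are equivalent to each other: (1) the projective hypersurface in $\mathbb{P}^{n-1}$ defined by $A_f(y_1,\ldots,y_n)=0$ is smooth, where $A_f$ is the associated form of $f$; (2) $\mathbb{P}(J(f)_{T-1})\cap \mathcal{V}^{T-1}_n=\emptyset$, the intersection being taken in $\mathbb{P}(S_{T-1})$. Then the Strong Lefschetz Property holds for $M(f)$ in degree $k=1$, i.e. for a generic linear form $\ell\in S_1$ the multiplication map $$\ell^{T-2}: M(f)_1\to M(f)_{T-1}$$ is an isomorphism. In particular, the Strong Lefschetz Property in degree $k=1$ holds for $M(f)$ for any generic polynomial $f\in S_d$.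
   Context: $S=\mathbb{C}[x_1,\ldots,x_n]$ has the standard grading, and $S_m$, $J_m$, $M_m$ denote degree $m$ homogeneous components. When the hypersurface $f=0$ is smooth, the partial derivatives $\partial f/\partial x_1,\ldots,\partial f/\partial x_n$ form a regular sequence and $M(f)$ is a graded Artinian Gorenstein algebra with socle degree $T=n(d-2)$. Associated form: let $\mathrm{Hess}(f)=\det(\partial^2 f/\partial x_i\partial x_j)$, whose class spans the socle $\mathrm{Soc}(M(f))=M(f)_T$, and let $\omega:\mathrm{Soc}(M(f))\to\mathbb{C}$ be the linear isomorphism with $\omega(\overline{\mathrm{Hess}(f)})=1$. Then $A_f\in \mathbb{C}[y_1,\ldots,y_n]$ is the homogeneous polynomial of degree $T$ defined by $A_f(y_1,\ldots,y_n)=\omega\big((y_1\overline{x_1}+\cdots+y_n\overline{x_n})^T\big)$, where $\overline{x_i}\in M(f)$ is the class of $x_i$. (It is a Macaulay inverse system of $M(f)$, which is unique up to a non-zero scalar.) Veronese variety: $\mathcal{V}^m_n\subset\mathbb{P}(S_m)$ is the image of the map $\mathbb{P}(S_1)\to\mathbb{P}(S_m)$, $\ell\mapsto \ell^m$. "Generic" means: for all elements of some non-empty Zariski open subset of the relevant vector space ($S_1$ for linear forms, $S_d$ for polynomials $f$). *)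

theory Defs
  imports
    "HOL-Analysis.Determinants"
    "HOL-Library.Poly_Mapping"
    "HOL-Algebra.Algebraic_Closure_Type"
begin

section \<open>Polynomials and forms\<close>

text \<open>
  A polynomial is a finitely supported function from exponent vectors to coefficients, with the
  convolution product of \<^theory>\<open>HOL-Library.Poly_Mapping\<close>.  For \<open>'n :: finite\<close>, the type
  \<open>'n cpoly\<close> is the polynomial ring over the complex numbers in \<open>CARD('n)\<close> variables.
\<close>

type_synonym 'v cpoly = "('v \<Rightarrow>\<^sub>0 nat) \<Rightarrow>\<^sub>0 complex"

definition cst :: "complex \<Rightarrow> 'v cpoly" where
  "cst c = Poly_Mapping.single 0 c"

definition var :: "'v \<Rightarrow> 'v cpoly" where
  "var i = Poly_Mapping.single (Poly_Mapping.single i 1) 1"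

definition poly_eval :: "('v \<Rightarrow> complex) \<Rightarrow> 'v cpoly \<Rightarrow> complex" where
  "poly_eval x p =
     (\<Sum>t\<in>Poly_Mapping.keys p. Poly_Mapping.lookup p t *
        (\<Prod>i\<in>Poly_Mapping.keys t. x i ^ Poly_Mapping.lookup t i))"

text \<open>The partial derivative.  The truncated subtraction of exponents is harmless: if \<open>i\<close>
  does not occur in \<open>t\<close>, then the coefficient is \<open>0\<close>.\<close>

definition pd :: "'v \<Rightarrow> 'v cpoly \<Rightarrow> 'v cpoly" where
  "pd i p =
     (\<Sum>t\<in>Poly_Mapping.keys p.
        Poly_Mapping.single (t - Poly_Mapping.single i 1)
          (of_nat (Poly_Mapping.lookup t i) * Poly_Mapping.lookup p t))"

text \<open>The homogeneous component \<open>S\<^sub>m\<close>, including \<open>0\<close>.\<close>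

definition forms :: "nat \<Rightarrow> 'n::finite cpoly set" where
  "forms m = {p. \<forall>t\<in>Poly_Mapping.keys p. (\<Sum>i\<in>UNIV. Poly_Mapping.lookup t i) = m}"

definition linear_form :: "complex ^ 'n \<Rightarrow> 'n::finite cpoly" where
  "linear_form y = (\<Sum>i\<in>UNIV. cst (y $ i) * var i)"

section \<open>Zariski topology on the space of forms and genericity\<close>

text \<open>The coordinates of a form are its coefficients, so a polynomial function on \<open>S\<^sub>m\<close> is given by a
  polynomial whose variables are indexed by the exponent vectors (those of degree other than \<open>m\<close>
  are evaluated at \<open>0\<close>).\<close>

definition zariski_closed :: "nat \<Rightarrow> 'n::finite cpoly set \<Rightarrow> bool" where
  "zariski_closed m Z \<longleftrightarrow>
     (\<exists>Q :: ('n \<Rightarrow>\<^sub>0 nat) cpoly set.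
        Z = {p \<in> forms m. \<forall>q\<in>Q. poly_eval (Poly_Mapping.lookup p) q = 0})"

definition zariski_open :: "nat \<Rightarrow> 'n::finite cpoly set \<Rightarrow> bool" where
  "zariski_open m U \<longleftrightarrow> U \<subseteq> forms m \<and> zariski_closed m (forms m - U)"

definition generic :: "nat \<Rightarrow> ('n::finite cpoly \<Rightarrow> bool) \<Rightarrow> bool" where
  "generic m P \<longleftrightarrow> (\<exists>U. zariski_open m U \<and> U \<noteq> {} \<and> (\<forall>p\<in>U. P p))"

section \<open>Projective notions\<close>

text \<open>Jacobian criterion, in homogeneous coordinates.  The zero form is not smooth.\<close>

definition smooth_hypersurface :: "'n::finite cpoly \<Rightarrow> bool" where
  "smooth_hypersurface p \<longleftrightarrow>
     (\<forall>v :: complex ^ 'n. v \<noteq> 0 \<and> poly_eval (($) v) p = 0 \<longrightarrow>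
        (\<exists>i. poly_eval (($) v) (pd i p) \<noteq> 0))"

text \<open>Points of a projective space are represented by the lines they are.\<close>

definition proj_point :: "'v cpoly \<Rightarrow> 'v cpoly set" where
  "proj_point p = {cst c * p | c. True}"

definition proj_space :: "'v cpoly set \<Rightarrow> 'v cpoly set set" where
  "proj_space V = proj_point ` (V - {0})"

definition veronese :: "nat \<Rightarrow> 'n::finite cpoly set set" where
  "veronese m = (\<lambda>l. proj_point (l ^ m)) ` (forms 1 - {0})"

section \<open>The Milnor algebra\<close>

definition jacobian_ideal :: "'n::finite cpoly \<Rightarrow> 'n cpoly set" where
  "jacobian_ideal f = Idl\<^bsub>ring_of_type_algebra\<^esub> {pd i f | i. True}"

definition milnor_algebra :: "'n::finite cpoly \<Rightarrow> 'n cpoly set ring" where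
  "milnor_algebra f = ring_of_type_algebra Quot jacobian_ideal f"

definition milnor_class :: "'n::finite cpoly \<Rightarrow> 'n cpoly \<Rightarrow> 'n cpoly set" where
  "milnor_class f p = jacobian_ideal f +>\<^bsub>ring_of_type_algebra\<^esub> p"

text \<open>Scalars act through the classes of the constants.\<close>

definition milnor_scale :: "'n::finite cpoly \<Rightarrow> complex \<Rightarrow> 'n cpoly set \<Rightarrow> 'n cpoly set" where
  "milnor_scale f c a = milnor_class f (cst c) \<otimes>\<^bsub>milnor_algebra f\<^esub> a"

definition milnor_component :: "'n::finite cpoly \<Rightarrow> nat \<Rightarrow> 'n cpoly set set" where
  "milnor_component f m = milnor_class f ` forms m"

text \<open>The socle is the annihilator of the ideal generated by the classes of the variables.\<close>

definition milnor_socle :: "'n::finite cpoly \<Rightarrow> 'n cpoly set set" where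
  "milnor_socle f =
     {a \<in> carrier (milnor_algebra f).
        \<forall>i. milnor_class f (var i) \<otimes>\<^bsub>milnor_algebra f\<^esub> a = \<zero>\<^bsub>milnor_algebra f\<^esub>}"

section \<open>The associated form\<close>

definition hessian :: "'n::finite cpoly \<Rightarrow> 'n cpoly" where
  "hessian f = det (\<chi> i j. pd i (pd j f))"

definition is_socle_iso :: "'n::finite cpoly \<Rightarrow> ('n cpoly set \<Rightarrow> complex) \<Rightarrow> bool" where
  "is_socle_iso f w \<longleftrightarrow>
     bij_betw w (milnor_socle f) UNIV \<and>
     (\<forall>a\<in>milnor_socle f. \<forall>b\<in>milnor_socle f. w (a \<oplus>\<^bsub>milnor_algebra f\<^esub> b) = w a + w b) \<and>
     (\<forall>c. \<forall>a\<in>milnor_socle f. w (milnor_scale f c a) = c * w a)"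

text \<open>When \<open>f = 0\<close> is smooth, the two conditions determine \<open>\<omega>\<close> on the socle, which is
  spanned by the class of the Hessian.  Values elsewhere are arbitrary and never used.\<close>

definition socle_omega :: "'n::finite cpoly \<Rightarrow> 'n cpoly set \<Rightarrow> complex" where
  "socle_omega f = (SOME w. is_socle_iso f w \<and> w (milnor_class f (hessian f)) = 1)"

text \<open>The variables \<open>y\<^sub>i\<close> are again indexed by \<open>'n\<close>.  A polynomial over an infinite field is
  determined by its values, so the description is unique.\<close>

definition associated_form :: "nat \<Rightarrow> 'n::finite cpoly \<Rightarrow> 'n cpoly" where
  "associated_form T f =
     (THE A. A \<in> forms T \<and>
        (\<forall>y :: complex ^ 'n.
           poly_eval (($) y) A =
             socle_omega f (milnor_class f (linear_form y) [^]\<^bsub>milnor_algebra f\<^esub> T)))"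

section \<open>The strong Lefschetz property\<close>

definition is_milnor_linear_iso ::
    "'n::finite cpoly \<Rightarrow> 'n cpoly set set \<Rightarrow> 'n cpoly set set \<Rightarrow> ('n cpoly set \<Rightarrow> 'n cpoly set) \<Rightarrow> bool"
  where
  "is_milnor_linear_iso f A B h \<longleftrightarrow>
     bij_betw h A B \<and>
     (\<forall>a\<in>A. \<forall>b\<in>A. h (a \<oplus>\<^bsub>milnor_algebra f\<^esub> b) = h a \<oplus>\<^bsub>milnor_algebra f\<^esub> h b) \<and>
     (\<forall>c. \<forall>a\<in>A. h (milnor_scale f c a) = milnor_scale f c (h a))"

definition strong_lefschetz_in_degree :: "nat \<Rightarrow> 'n::finite cpoly \<Rightarrow> nat \<Rightarrow> bool" where
  "strong_lefschetz_in_degree T f k \<longleftrightarrow>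
     generic 1 (\<lambda>l. is_milnor_linear_iso f (milnor_component f k) (milnor_component f (T - k))
       (\<lambda>a. (milnor_class f l [^]\<^bsub>milnor_algebra f\<^esub> (T - 2 * k)) \<otimes>\<^bsub>milnor_algebra f\<^esub> a))"

end

theory Submission
  imports Defs "HOL-Computational_Algebra.Fundamental_Theorem_Algebra"
    "HOL-Analysis.Continuum_Not_Denumerable"
begin

text \<open>
  Everything rests on Gorenstein duality for \<open>M(f)\<close> (\<open>socle_functional\<close>, \<open>socle_dual_exists\<close>): for
  smooth \<open>f\<close> there is a linear functional \<open>l\<close> on the polynomials that vanishes on \<open>J(f)\<close>, takes the
  value \<open>1\<close> at the Hessian, and satisfies \<open>p \<equiv> l p \<cdot> Hess f\<close> modulo \<open>J(f)\<close> for every \<open>p\<close> in the socle.  The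
  partial derivatives \<open>g\<^sub>i\<close> of \<open>f\<close> have no common zero besides
  the origin, so by the Nullstellensatz \<open>x\<^sub>i\<^sup>N\<close> lies in \<open>J(f)\<close> for some \<open>N\<close> (\<open>power_in_ideal_gen\<close>).  Writing
  \<open>x\<^sup>N = b g\<close>, one takes for \<open>l h\<close> the coefficient of \<open>\<Prod>x\<^sub>i\<^sup>N\<^sup>-\<^sup>1\<close> in \<open>det b h\<close>, up to a factor; that the
  Hessian spans the socle follows by evaluating \<open>l\<close> on the Bezoutian of \<open>g\<close>.  Since \<open>J(f)\<close> is
  graded, the socle is \<open>M(f)\<^sub>T\<close>, and \<open>(p, q) \<mapsto> l (p q)\<close> is a perfect pairing of \<open>M(f)\<^sub>k\<close> with
  \<open>M(f)\<^sub>T\<^sub>-\<^sub>k\<close>.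

  Let \<open>\<ell> = \<Sum>y\<^sub>i x\<^sub>i\<close>.  The associated form is \<open>A y = l (\<ell>\<^sup>T)\<close>, its first derivatives are
  \<open>T l (x\<^sub>i \<ell>\<^sup>T\<^sup>-\<^sup>1)\<close>, and its second derivatives are \<open>T (T - 1) l (x\<^sub>i x\<^sub>j \<ell>\<^sup>T\<^sup>-\<^sup>2)\<close>.  The first
  derivatives vanish at \<open>y\<close> if and only if \<open>\<ell>\<^sup>T\<^sup>-\<^sup>1\<close> lies in \<open>J(f)\<close>, which is the equivalence of
  smoothness of \<open>A\<close> and the condition on the Veronese variety (\<open>smooth_associated_form_iff\<close>).  The
  matrix of second derivatives represents multiplication by \<open>\<ell>\<^sup>T\<^sup>-\<^sup>2\<close> from \<open>M(f)\<^sub>1\<close> to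
  \<open>M(f)\<^sub>T\<^sub>-\<^sub>1\<close>, the dual of \<open>M(f)\<^sub>1\<close>.  So the strong Lefschetz property in degree one holds as soon
  as the Hessian of \<open>A\<close> is not the zero polynomial (\<open>strong_lefschetz_of_hess_at\<close>).  If \<open>A\<close> is smooth,
  duality applied to \<open>A\<close> in place of \<open>f\<close> shows that its Hessian is not even in \<open>J(A)\<close>.

  For generic \<open>f\<close> it suffices to satisfy two open conditions at one form: that \<open>J(f)\<close> contains all
  forms of degree \<open>T + 1\<close>, which forces \<open>f\<close> to be smooth, and that multiplication by
  \<open>(x\<^sub>1 + \<dots> + x\<^sub>n)\<^sup>T\<^sup>-\<^sup>2\<close> is onto \<open>M(f)\<^sub>T\<^sub>-\<^sub>1\<close>.  Openness is Gaussian elimination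
  (\<open>surjective_open\<close>), and the Fermat form satisfies both (\<open>fermat_surjective\<close>).
\<close>

abbreviation "lookup \<equiv> Poly_Mapping.lookup"
abbreviation "keys \<equiv> Poly_Mapping.keys"
abbreviation "single \<equiv> Poly_Mapping.single"

abbreviation unit_exp :: "'v \<Rightarrow> 'v \<Rightarrow>\<^sub>0 nat" where
  "unit_exp i \<equiv> single i 1"

section \<open>Coefficients, products and evaluation\<close>

lemma poly_mapping_expand:
  fixes p :: "'a \<Rightarrow>\<^sub>0 'b::comm_monoid_add"
  shows "p = (\<Sum>t\<in>keys p. single t (lookup p t))"
proof (rule poly_mapping_eqI)
  fix k
  have "lookup (\<Sum>t\<in>keys p. single t (lookup p t)) k = (\<Sum>t\<in>keys p. if t = k then lookup p t else 0)"
    by (simp add: lookup_sum lookup_single when_def)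
  also have "\<dots> = lookup p k"
    by (simp add: sum.delta' in_keys_iff)
  finally show "lookup p k = lookup (\<Sum>t\<in>keys p. single t (lookup p t)) k" by simp
qed

lemma poly_mapping_monomial_induct [case_names single add]:
  fixes p :: "'a \<Rightarrow>\<^sub>0 'b::comm_monoid_add"
  assumes "\<And>t c. P (single t c)" and "\<And>p q. P p \<Longrightarrow> P q \<Longrightarrow> P (p + q)"
  shows "P p"
proof -
  have "P (\<Sum>t\<in>A. single t (lookup p t))" if "finite A" for A
    using that
  proof (induction A rule: finite_induct)
    case empty
    then show ?case using assms(1)[of undefined 0] by simp
  next
    case (insert x F)
    then show ?case using assms(2)[OF assms(1)[of x "lookup p x"] insert.IH] by simp
  qed
  from this[of "keys p"] show ?thesis
    unfolding poly_mapping_expand[of p, symmetric] by simp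
qed

lemma additive_multiplicative:
  fixes F :: "('a::comm_monoid_add \<Rightarrow>\<^sub>0 'b::comm_semiring_1) \<Rightarrow> 'c::comm_semiring_1"
  assumes add: "\<And>p q. F (p + q) = F p + F q"
    and mult: "\<And>s a t b. F (single s a * single t b) = F (single s a) * F (single t b)"
  shows "F (p * q) = F p * F q"
proof (induction p rule: poly_mapping_monomial_induct)
  case (single s a)
  show ?case
    by (induction q rule: poly_mapping_monomial_induct) (simp_all add: mult add distrib_left)
next
  case (add p p')
  then show ?case by (simp add: assms(1) distrib_right)
qed

lemma lookup_single_mult_add:
  fixes s u :: "'v \<Rightarrow>\<^sub>0 nat"
  shows "lookup (single s a * p) (s + u) = a * lookup p u"
  by (induction p rule: poly_mapping_monomial_induct)
     (auto simp: mult_single lookup_single when_def lookup_add distrib_left)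

lemma lookup_single_mult_other:
  fixes s t :: "'v \<Rightarrow>\<^sub>0 nat"
  assumes "lookup t i < lookup s i"
  shows "lookup (single s a * p) t = 0"
  using assms
  by (induction p rule: poly_mapping_monomial_induct)
     (auto simp: mult_single lookup_single when_def lookup_add distrib_left)

lemma exp_le_add_diff:
  fixes s t :: "'v \<Rightarrow>\<^sub>0 nat"
  assumes "\<And>i. lookup s i \<le> lookup t i"
  shows "t = s + (t - s)"
  using assms by (intro poly_mapping_eqI) (simp add: lookup_add lookup_minus)

lemma exp_split_unit:
  fixes t :: "'v \<Rightarrow>\<^sub>0 nat"
  assumes "lookup t i \<noteq> 0"
  shows "t = unit_exp i + (t - unit_exp i)"
  by (rule exp_le_add_diff) (use assms in \<open>auto simp: lookup_single when_def\<close>)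

lemma cst_add: "cst (a + b) = cst a + cst b"
  by (simp add: cst_def single_add)

lemma cst_mult: "cst (a * b) = cst a * cst b"
  by (simp add: cst_def mult_single)

lemma cst_0 [simp]: "cst 0 = 0"
  by (simp add: cst_def)

lemma cst_1 [simp]: "cst 1 = 1"
  by (simp add: cst_def)

lemma cst_uminus: "cst (- a) = - cst a"
  by (simp add: cst_def single_uminus)

lemma lookup_cst_mult [simp]: "lookup (cst c * p) t = c * lookup p t"
  using lookup_single_mult_add[of 0 c p t] by (simp add: cst_def)

definition mono_val :: "('v \<Rightarrow> complex) \<Rightarrow> ('v \<Rightarrow>\<^sub>0 nat) \<Rightarrow> complex" where
  "mono_val x t = (\<Prod>i\<in>keys t. x i ^ lookup t i)"

lemma mono_val_superset:
  assumes "finite A" "keys t \<subseteq> A"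
  shows "mono_val x t = (\<Prod>i\<in>A. x i ^ lookup t i)"
  unfolding mono_val_def
  by (rule prod.mono_neutral_left) (use assms in \<open>auto simp: in_keys_iff\<close>)

lemma mono_val_add: "mono_val x (s + t) = mono_val x s * mono_val x t"
proof -
  let ?A = "keys s \<union> keys t"
  have "keys (s + t) \<subseteq> ?A" by (rule keys_add)
  then show ?thesis
    by (simp add: mono_val_superset[of ?A] lookup_add power_add prod.distrib)
qed

lemma mono_val_0 [simp]: "mono_val x 0 = 1"
  by (simp add: mono_val_def)

lemma mono_val_unit_exp [simp]: "mono_val x (single i n) = x i ^ n"
  by (cases "n = 0") (simp_all add: mono_val_def)

lemma poly_eval_superset:
  assumes "finite A" "keys p \<subseteq> A"
  shows "poly_eval x p = (\<Sum>t\<in>A. lookup p t * mono_val x t)"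
  unfolding poly_eval_def mono_val_def[symmetric]
  by (rule sum.mono_neutral_left) (use assms in \<open>auto simp: in_keys_iff\<close>)

lemma poly_eval_add: "poly_eval x (p + q) = poly_eval x p + poly_eval x q"
proof -
  let ?A = "keys p \<union> keys q"
  have "keys (p + q) \<subseteq> ?A" by (rule keys_add)
  then show ?thesis
    by (simp add: poly_eval_superset[of ?A] lookup_add distrib_right sum.distrib)
qed

lemma poly_eval_single: "poly_eval x (single t c) = c * mono_val x t"
  by (subst poly_eval_superset[of "{t}"]) auto

lemma poly_eval_mult: "poly_eval x (p * q) = poly_eval x p * poly_eval x q"
  by (rule additive_multiplicative)
     (simp_all add: poly_eval_add mult_single poly_eval_single mono_val_add)

lemma poly_eval_cst [simp]: "poly_eval x (cst c) = c"
  by (simp add: cst_def poly_eval_single)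

lemma poly_eval_var [simp]: "poly_eval x (var i) = x i"
  by (simp add: var_def poly_eval_single)

lemma poly_eval_0 [simp]: "poly_eval x 0 = 0"
  using poly_eval_cst[of x 0] by simp

lemma poly_eval_1 [simp]: "poly_eval x 1 = 1"
  using poly_eval_cst[of x 1] by simp

lemma poly_eval_uminus: "poly_eval x (- p) = - poly_eval x p"
  using poly_eval_add[of x p "- p"] by (simp add: add_eq_0_iff)

lemma poly_eval_diff: "poly_eval x (p - q) = poly_eval x p - poly_eval x q"
  using poly_eval_add[of x p "- q"] by (simp add: poly_eval_uminus)

lemma poly_eval_sum: "poly_eval x (sum f A) = (\<Sum>a\<in>A. poly_eval x (f a))"
  by (induction A rule: infinite_finite_induct) (simp_all add: poly_eval_add)

lemma poly_eval_prod: "poly_eval x (prod f A) = (\<Prod>a\<in>A. poly_eval x (f a))"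
  by (induction A rule: infinite_finite_induct) (simp_all add: poly_eval_mult)

lemma poly_eval_power: "poly_eval x (p ^ n) = poly_eval x p ^ n"
  by (induction n) (simp_all add: poly_eval_mult)

text \<open>Two different exponents differ in some coordinate \<open>i\<close>, and doubling \<open>x\<^sub>i\<close> multiplies the two
  monomials by different powers of two.  Subtracting a multiple of the original relation from the
  rescaled one cancels a chosen term and keeps another one, so the number of terms goes down.\<close>

lemma monomials_independent:
  fixes c :: "('v \<Rightarrow>\<^sub>0 nat) \<Rightarrow> complex"
  assumes "finite K" and "\<And>x. (\<Sum>t\<in>K. c t * mono_val x t) = 0" and "t \<in> K"
  shows "c t = 0"
  using assms
proof (induction K arbitrary: c t rule: finite_induct)
  case (insert t0 K)
  have double: "mono_val (x(i := 2 * x i)) s = 2 ^ lookup s i * mono_val x s" for x i and s :: "'v \<Rightarrow>\<^sub>0 nat"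
  proof -
    let ?A = "insert i (keys s)"
    have fin: "finite ?A" "keys s \<subseteq> ?A" by auto
    have "mono_val (x(i := 2 * x i)) s = (\<Prod>j\<in>?A. (if j = i then 2 ^ lookup s i else 1) * x j ^ lookup s j)"
      unfolding mono_val_superset[OF fin] by (rule prod.cong) (auto simp: power_mult_distrib)
    also have "\<dots> = 2 ^ lookup s i * mono_val x s"
      unfolding prod.distrib mono_val_superset[OF fin, of x] by (simp add: prod.delta)
    finally show ?thesis .
  qed
  have zero: "c s = 0" if s: "s \<in> K" for s
  proof -
    have "s \<noteq> t0" using s insert.hyps by auto
    then obtain i where i: "lookup s i \<noteq> lookup t0 i" by (metis poly_mapping_eqI)
    let ?c = "\<lambda>s. c s * (2 ^ lookup s i - 2 ^ lookup t0 i)"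
    have "(\<Sum>s\<in>K. ?c s * mono_val x s) = 0" for x
    proof -
      have e1: "(\<Sum>s\<in>insert t0 K. c s * mono_val (x(i := 2 * x i)) s) = 0"
        and e2: "(\<Sum>s\<in>insert t0 K. c s * mono_val x s) = 0" by (rule insert.prems)+
      have "(\<Sum>s\<in>insert t0 K. ?c s * mono_val x s)
          = (\<Sum>s\<in>insert t0 K. c s * mono_val (x(i := 2 * x i)) s)
            - 2 ^ lookup t0 i * (\<Sum>s\<in>insert t0 K. c s * mono_val x s)"
        unfolding double sum_distrib_left sum_subtractf[symmetric]
        by (rule sum.cong) (simp_all add: algebra_simps)
      also have "\<dots> = 0" using e1 e2 by simp
      finally show ?thesis using insert.hyps by simp
    qed
    then have "?c s = 0" using insert.IH[of ?c s] s by blast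
    moreover have "(2::complex) ^ lookup s i \<noteq> 2 ^ lookup t0 i"
    proof -
      have "(2::nat) ^ lookup s i \<noteq> 2 ^ lookup t0 i" using i by simp
      then have "of_nat (2 ^ lookup s i) \<noteq> (of_nat (2 ^ lookup t0 i) :: complex)"
        by (simp only: of_nat_eq_iff not_False_eq_True)
      then show ?thesis unfolding of_nat_power of_nat_numeral .
    qed
    ultimately show ?thesis by simp
  qed
  moreover have "c t0 = 0"
  proof -
    have "c t0 * mono_val (\<lambda>_. 1) t0 = 0"
      using insert.prems(1)[of "\<lambda>_. 1"] insert.hyps zero by simp
    then show ?thesis by (simp add: mono_val_def)
  qed
  ultimately show ?case using insert.prems by auto
qed simp

lemma poly_eval_eq_0_imp:
  fixes p :: "'v cpoly"
  assumes "\<And>x. poly_eval x p = 0"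
  shows "p = 0"
proof (rule poly_mapping_eqI)
  fix t
  have "\<forall>t\<in>keys p. lookup p t = 0"
    using monomials_independent[of "keys p" "lookup p"] assms
    by (simp add: poly_eval_superset[of "keys p"])
  then show "lookup p t = lookup 0 t" by (cases "t \<in> keys p") (auto simp: in_keys_iff)
qed

lemma poly_eval_vec_eq_0_imp:
  fixes p :: "'n::finite cpoly"
  assumes "\<And>y :: complex ^ 'n. poly_eval (($) y) p = 0"
  shows "p = 0"
proof (rule poly_eval_eq_0_imp)
  fix x :: "'n \<Rightarrow> complex"
  have "($) (\<chi> i. x i) = x" by auto
  then show "poly_eval x p = 0" using assms[of "\<chi> i. x i"] by simp
qed

section \<open>Partial derivatives\<close>

lemma lookup_pd: "lookup (pd i p) t = of_nat (lookup t i + 1) * lookup p (t + unit_exp i)"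
proof -
  have e: "s - unit_exp i = t \<longleftrightarrow> s = t + unit_exp i" if "lookup s i \<noteq> 0" for s
  proof
    assume "s - unit_exp i = t"
    moreover have "s = unit_exp i + (s - unit_exp i)"
      using that by (rule exp_split_unit)
    ultimately show "s = t + unit_exp i" by (simp add: add.commute)
  qed simp
  have "lookup (pd i p) t
      = (\<Sum>s\<in>keys p. if s = t + unit_exp i then of_nat (lookup s i) * lookup p s else 0)"
    unfolding pd_def lookup_sum lookup_single when_def
  proof (rule sum.cong[OF refl])
    fix s
    show "(if s - unit_exp i = t then of_nat (lookup s i) * lookup p s else 0)
        = (if s = t + unit_exp i then of_nat (lookup s i) * lookup p s else 0)"
      using e[of s] by (cases "lookup s i = 0") auto
  qed
  also have "\<dots> = of_nat (lookup (t + unit_exp i) i) * lookup p (t + unit_exp i)"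
    by (simp add: sum.delta in_keys_iff)
  finally show ?thesis by (simp add: lookup_add)
qed

lemma pd_add: "pd i (p + q) = pd i p + pd i q"
  by (rule poly_mapping_eqI) (simp add: lookup_pd lookup_add distrib_left)

lemma pd_0 [simp]: "pd i 0 = 0"
  by (rule poly_mapping_eqI) (simp add: lookup_pd)

lemma pd_sum: "pd i (sum f A) = (\<Sum>a\<in>A. pd i (f a))"
  by (induction A rule: infinite_finite_induct) (simp_all add: pd_add)

lemma pd_commute: "pd i (pd j p) = pd j (pd i p)"
proof (cases "i = j")
  case False
  then show ?thesis
    by (intro poly_mapping_eqI) (simp add: lookup_pd lookup_add lookup_single when_def ac_simps)
qed simp

lemma lookup_var_mult:
  "lookup (var i * p) t = (if lookup t i = 0 then 0 else lookup p (t - unit_exp i))"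
proof (cases "lookup t i = 0")
  case True
  then show ?thesis using lookup_single_mult_other[of t i "unit_exp i" 1 p] by (simp add: var_def)
next
  case False
  have "t = unit_exp i + (t - unit_exp i)"
    using False by (rule exp_split_unit)
  then have "lookup (var i * p) t = lookup p (t - unit_exp i)"
    using lookup_single_mult_add[of "unit_exp i" 1 p "t - unit_exp i"] by (simp add: var_def)
  then show ?thesis using False by simp
qed

lemma var_pd_lookup: "lookup (var i * pd i p) t = of_nat (lookup t i) * lookup p t"
proof (cases "lookup t i = 0")
  case True
  then show ?thesis by (simp add: lookup_var_mult)
next
  case False
  have "t = unit_exp i + (t - unit_exp i)"
    using False by (rule exp_split_unit)
  then have "t - unit_exp i + unit_exp i = t" by (simp add: add.commute)
  then show ?thesis using False by (simp add: lookup_var_mult lookup_pd lookup_minus)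
qed

lemma pd_var_mult: "pd j (var i * p) = (if i = j then p else 0) + var i * pd j p"
proof (rule poly_mapping_eqI)
  fix t
  show "lookup (pd j (var i * p)) t = lookup ((if i = j then p else 0) + var i * pd j p) t"
  proof (cases "i = j")
    case True
    have "lookup (pd i (var i * p)) t = of_nat (lookup t i + 1) * lookup p t"
      unfolding lookup_pd lookup_var_mult by (simp add: lookup_add)
    also have "\<dots> = lookup p t + lookup (var i * pd i p) t"
      unfolding var_pd_lookup of_nat_add of_nat_1 distrib_right mult_1_left by (rule add.commute)
    finally show ?thesis unfolding True[symmetric] lookup_add if_True refl[THEN eqTrueI] .
  next
    case ij: False
    show ?thesis
    proof (cases "lookup t i = 0")
      case True
      then show ?thesis using ij
        by (simp add: lookup_pd lookup_var_mult lookup_add lookup_single when_def)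
    next
      case False
      have "t + unit_exp j - unit_exp i = t - unit_exp i + unit_exp j"
        by (rule poly_mapping_eqI)
           (use False ij in \<open>auto simp: lookup_add lookup_minus lookup_single when_def\<close>)
      then show ?thesis using ij False
        by (simp add: lookup_pd lookup_var_mult lookup_add lookup_single when_def lookup_minus)
    qed
  qed
qed

section \<open>Homogeneous components\<close>

definition tdeg :: "('n::finite \<Rightarrow>\<^sub>0 nat) \<Rightarrow> nat" where
  "tdeg t = (\<Sum>i\<in>UNIV. lookup t i)"

lemma tdeg_add [simp]: "tdeg (s + t) = tdeg s + tdeg t"
  by (simp add: tdeg_def lookup_add sum.distrib)

lemma tdeg_single [simp]: "tdeg (single i n) = n"
  by (simp add: tdeg_def lookup_single when_def)

lemma tdeg_0 [simp]: "tdeg 0 = 0"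
  by (simp add: tdeg_def)

lemma tdeg_eq_0 [simp]: "tdeg t = 0 \<longleftrightarrow> t = 0"
proof
  assume "tdeg t = 0"
  then show "t = 0" by (intro poly_mapping_eqI) (simp add: tdeg_def)
qed simp

lemma inj_lookup: "inj (lookup :: ('a \<Rightarrow>\<^sub>0 'b::zero) \<Rightarrow> 'a \<Rightarrow> 'b)"
  by (rule injI, rule poly_mapping_eqI) simp

lemma finite_tdeg: "finite {t :: 'n::finite \<Rightarrow>\<^sub>0 nat. tdeg t = m}"
proof -
  have "{t :: 'n \<Rightarrow>\<^sub>0 nat. tdeg t = m} \<subseteq> lookup -` (UNIV \<rightarrow>\<^sub>E {..m})"
  proof
    fix t :: "'n \<Rightarrow>\<^sub>0 nat"
    assume "t \<in> {t. tdeg t = m}"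
    then have "lookup t i \<le> m" for i
      using member_le_sum[of i UNIV "lookup t"] by (simp add: tdeg_def)
    then show "t \<in> lookup -` (UNIV \<rightarrow>\<^sub>E {..m})" by (auto simp: PiE_def extensional_def)
  qed
  moreover have "finite (lookup -` (UNIV \<rightarrow>\<^sub>E {..m}) :: ('n \<Rightarrow>\<^sub>0 nat) set)"
    by (intro finite_vimageI finite_PiE inj_lookup) auto
  ultimately show ?thesis by (rule finite_subset)
qed

lemma forms_iff: "p \<in> forms m \<longleftrightarrow> (\<forall>t. tdeg t \<noteq> m \<longrightarrow> lookup p t = 0)"
  unfolding forms_def tdeg_def by (auto simp: in_keys_iff)

lemma forms_0 [simp]: "0 \<in> forms m"
  by (simp add: forms_iff)

lemma forms_add: "p \<in> forms m \<Longrightarrow> q \<in> forms m \<Longrightarrow> p + q \<in> forms m"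
  by (simp add: forms_iff lookup_add)

lemma forms_diff: "p \<in> forms m \<Longrightarrow> q \<in> forms m \<Longrightarrow> p - q \<in> forms m"
  by (simp add: forms_iff lookup_minus)

lemma forms_cst_mult: "p \<in> forms m \<Longrightarrow> cst c * p \<in> forms m"
  by (simp add: forms_iff)

lemma forms_sum: "(\<And>a. a \<in> A \<Longrightarrow> f a \<in> forms m) \<Longrightarrow> sum f A \<in> forms m"
  by (induction A rule: infinite_finite_induct) (auto intro: forms_add)

lemma forms_single: "single t c \<in> forms (tdeg t)"
  by (auto simp: forms_iff lookup_single when_def)

lemma forms_var: "var i \<in> forms 1"
  unfolding var_def using forms_single[of "unit_exp i" 1] by simp

lemma forms_1: "1 \<in> forms 0"
  using forms_single[of 0 1] by simp

lemma forms_mult: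
  assumes "p \<in> forms a" "q \<in> forms b"
  shows "p * q \<in> forms (a + b)"
proof -
  have "t \<in> keys (p * q) \<Longrightarrow> tdeg t = a + b" for t
  proof -
    assume "t \<in> keys (p * q)"
    then obtain u v where "t = u + v" "u \<in> keys p" "v \<in> keys q"
      using keys_mult[of p q] by blast
    then show "tdeg t = a + b"
      using assms unfolding forms_iff by (metis in_keys_iff tdeg_add)
  qed
  then show ?thesis unfolding forms_iff by (metis in_keys_iff)
qed

lemma forms_var_mult: "p \<in> forms m \<Longrightarrow> var i * p \<in> forms (Suc m)"
  using forms_mult[OF forms_var] by simp

lemma forms_power: "p \<in> forms m \<Longrightarrow> p ^ k \<in> forms (k * m)"
  by (induction k) (auto intro: forms_1 forms_mult simp: add.commute)

lemma forms_prod: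
  "finite A \<Longrightarrow> (\<And>a. a \<in> A \<Longrightarrow> f a \<in> forms m) \<Longrightarrow> prod f A \<in> forms (card A * m)"
  by (induction A rule: finite_induct) (auto intro: forms_1 forms_mult)

lemma forms_of_int_mult: "p \<in> forms m \<Longrightarrow> of_int k * p \<in> forms m"
  using forms_cst_mult[of p m "of_int k"] by (simp add: cst_def)

lemma forms_det:
  fixes A :: "'n::finite cpoly ^ 'n ^ 'n"
  assumes "\<And>i j. A $ i $ j \<in> forms m"
  shows "det A \<in> forms (CARD('n) * m)"
  unfolding det_def
  by (intro forms_sum forms_of_int_mult forms_prod) (auto intro: assms)

lemma pd_forms: "p \<in> forms (Suc m) \<Longrightarrow> pd i p \<in> forms m"
  by (simp add: forms_iff lookup_pd)

lemma euler:
  assumes "p \<in> forms m"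
  shows "(\<Sum>i\<in>UNIV. var i * pd i p) = cst (of_nat m) * p"
proof (rule poly_mapping_eqI)
  fix t
  have "lookup (\<Sum>i\<in>UNIV. var i * pd i p) t = of_nat (tdeg t) * lookup p t"
    by (simp add: lookup_sum var_pd_lookup tdeg_def sum_distrib_right)
  then show "lookup (\<Sum>i\<in>UNIV. var i * pd i p) t = lookup (cst (of_nat m) * p) t"
    using assms by (cases "tdeg t = m") (auto simp: forms_iff)
qed

lift_definition hcomp :: "nat \<Rightarrow> 'n::finite cpoly \<Rightarrow> 'n cpoly" is
  "\<lambda>m p t. if tdeg t = m then p t else 0"
  by (erule finite_subset[rotated]) auto

lemma lookup_hcomp: "lookup (hcomp m p) t = (if tdeg t = m then lookup p t else 0)"
  by transfer simp

lemma hcomp_add: "hcomp m (p + q) = hcomp m p + hcomp m q"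
  by (rule poly_mapping_eqI) (simp add: lookup_hcomp lookup_add)

lemma hcomp_diff: "hcomp m (p - q) = hcomp m p - hcomp m q"
  by (rule poly_mapping_eqI) (simp add: lookup_hcomp lookup_minus)

lemma hcomp_0 [simp]: "hcomp m 0 = 0"
  by (rule poly_mapping_eqI) (simp add: lookup_hcomp)

lemma hcomp_sum: "hcomp m (sum f A) = (\<Sum>a\<in>A. hcomp m (f a))"
  by (induction A rule: infinite_finite_induct) (simp_all add: hcomp_add)

lemma hcomp_of_form: "p \<in> forms k \<Longrightarrow> hcomp m p = (if k = m then p else 0)"
  by (rule poly_mapping_eqI) (auto simp: lookup_hcomp forms_iff)

lemma hcomp_mult_form:
  assumes "g \<in> forms e"
  shows "hcomp (m + e) (c * g) = hcomp m c * g" and "m < e \<Longrightarrow> hcomp m (c * g) = 0"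
proof -
  have *: "hcomp k (c * g) = (if e \<le> k then hcomp (k - e) c * g else 0)" for k
  proof (induction c rule: poly_mapping_monomial_induct)
    case (single t a)
    have "single t a * g \<in> forms (tdeg t + e)"
      by (intro forms_mult forms_single assms)
    then have "hcomp k (single t a * g) = (if tdeg t + e = k then single t a * g else 0)"
      by (rule hcomp_of_form)
    moreover have "hcomp (k - e) (single t a) = (if tdeg t = k - e then single t a else 0)"
      by (rule hcomp_of_form[OF forms_single])
    ultimately show ?case by auto
  next
    case (add p q)
    then show ?case by (simp add: hcomp_add distrib_right)
  qed
  show "hcomp (m + e) (c * g) = hcomp m c * g" by (simp add: *)
  show "hcomp m (c * g) = 0" if "m < e" using that by (simp add: *)
qed

lemma hcomp_var_mult: "hcomp (Suc m) (c * var i) = hcomp m c * var i"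
  using hcomp_mult_form(1)[OF forms_var, of m c i] by simp

lemma hcomp_eventually_0: "\<exists>m. hcomp m p = 0"
proof -
  obtain m where "m \<notin> tdeg ` keys p"
    using ex_new_if_finite[of "tdeg ` keys p"] by auto
  then have "hcomp m p = 0"
    by (intro poly_mapping_eqI) (auto simp: lookup_hcomp in_keys_iff image_iff)
  then show ?thesis ..
qed

section \<open>Ideals generated by a finite family\<close>

definition ideal_gen :: "('i::finite \<Rightarrow> 'a::comm_ring_1) \<Rightarrow> 'a set" where
  "ideal_gen g = {\<Sum>i\<in>UNIV. c i * g i | c. True}"

lemma ideal_genI: "p = (\<Sum>i\<in>UNIV. c i * g i) \<Longrightarrow> p \<in> ideal_gen g"
  unfolding ideal_gen_def by (rule CollectI) (intro exI conjI TrueI)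

lemma ideal_gen_base: "g i \<in> ideal_gen g"
proof -
  have "g i = (\<Sum>j\<in>UNIV. (if j = i then 1 else 0) * g j)"
    by (simp add: if_distrib[of "\<lambda>x. x * _"] sum.delta cong: if_cong)
  then show ?thesis by (rule ideal_genI)
qed

lemma ideal_gen_add:
  assumes "p \<in> ideal_gen g" "q \<in> ideal_gen g"
  shows "p + q \<in> ideal_gen g"
proof -
  obtain c c' where "p = (\<Sum>i\<in>UNIV. c i * g i)" "q = (\<Sum>i\<in>UNIV. c' i * g i)"
    using assms unfolding ideal_gen_def by auto
  then have "p + q = (\<Sum>i\<in>UNIV. (c i + c' i) * g i)"
    by (simp add: distrib_right sum.distrib)
  then show ?thesis by (rule ideal_genI)
qed

lemma ideal_gen_mult:
  assumes "p \<in> ideal_gen g"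
  shows "a * p \<in> ideal_gen g"
proof -
  obtain c where "p = (\<Sum>i\<in>UNIV. c i * g i)"
    using assms unfolding ideal_gen_def by auto
  then have "a * p = (\<Sum>i\<in>UNIV. (a * c i) * g i)"
    by (simp add: sum_distrib_left mult.assoc)
  then show ?thesis by (rule ideal_genI)
qed

lemma ideal_gen_0: "0 \<in> ideal_gen g"
  using ideal_gen_mult[OF ideal_gen_base, of 0 g] by simp

lemma ideal_gen_uminus: "p \<in> ideal_gen g \<Longrightarrow> - p \<in> ideal_gen g"
  using ideal_gen_mult[of p g "- 1"] by simp

lemma ideal_gen_diff: "p \<in> ideal_gen g \<Longrightarrow> q \<in> ideal_gen g \<Longrightarrow> p - q \<in> ideal_gen g"
  using ideal_gen_add[OF _ ideal_gen_uminus, of p g q] by simp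

lemma ideal_gen_sum: "(\<And>a. a \<in> A \<Longrightarrow> f a \<in> ideal_gen g) \<Longrightarrow> sum f A \<in> ideal_gen g"
  by (induction A rule: infinite_finite_induct) (auto intro: ideal_gen_0 ideal_gen_add)

lemma ideal_gen_hcomp:
  assumes g: "\<And>i. g i \<in> forms e" and "p \<in> ideal_gen g"
  shows "hcomp m p \<in> ideal_gen g"
proof -
  obtain c where "p = (\<Sum>i\<in>UNIV. c i * g i)"
    using assms unfolding ideal_gen_def by auto
  then have "hcomp m p = (\<Sum>i\<in>UNIV. hcomp m (c i * g i))" by (simp add: hcomp_sum)
  also have "\<dots> \<in> ideal_gen g"
  proof (rule ideal_gen_sum)
    fix i
    show "hcomp m (c i * g i) \<in> ideal_gen g"
    proof (cases "m < e")
      case True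
      then show ?thesis using hcomp_mult_form(2)[OF g] by (simp add: ideal_gen_0)
    next
      case False
      then show ?thesis using hcomp_mult_form(1)[OF g, of "m - e" "c i" i]
        by (simp add: ideal_gen_mult ideal_gen_base)
    qed
  qed
  finally show ?thesis .
qed

section \<open>The Nullstellensatz\<close>

text \<open>An equation with a non-zero coefficient can be solved for one unknown, which removes one
  equation and one unknown.\<close>

lemma homogeneous_system_solvable:
  fixes M :: "'e \<Rightarrow> 'c \<Rightarrow> complex"
  assumes "finite E" "finite C" "card E < card C"
  shows "\<exists>l. (\<exists>c\<in>C. l c \<noteq> 0) \<and> (\<forall>e\<in>E. (\<Sum>c\<in>C. l c * M e c) = 0)"
  using assms
proof (induction E arbitrary: C M rule: finite_induct)
  case empty
  then have "C \<noteq> {}" by auto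
  then show ?case by (intro exI[of _ "\<lambda>_. 1"]) auto
next
  case (insert e E)
  show ?case
  proof (cases "\<exists>c0\<in>C. M e c0 \<noteq> 0")
    case False
    obtain l where "\<exists>c\<in>C. l c \<noteq> 0" "\<forall>e\<in>E. (\<Sum>c\<in>C. l c * M e c) = 0"
      using insert.IH[of C M] insert.prems insert.hyps by auto
    then show ?thesis using False by (intro exI[of _ l]) auto
  next
    case True
    then obtain c0 where c0: "c0 \<in> C" "M e c0 \<noteq> 0" by blast
    define M' where "M' = (\<lambda>e' c. M e' c - M e' c0 * M e c / M e c0)"
    have "card E < card (C - {c0})"
      using insert.prems insert.hyps c0 by simp
    then obtain l where l: "\<exists>c\<in>C - {c0}. l c \<noteq> 0" "\<forall>e\<in>E. (\<Sum>c\<in>C - {c0}. l c * M' e c) = 0"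
      using insert.IH[of "C - {c0}" M'] insert.prems(1) by blast
    define s where "s = (\<Sum>c\<in>C - {c0}. l c * M e c)"
    define l' where "l' = l(c0 := - s / M e c0)"
    have split: "(\<Sum>c\<in>C. l' c * M e' c) = (\<Sum>c\<in>C - {c0}. l c * M e' c) - s / M e c0 * M e' c0" for e'
    proof -
      have "(\<Sum>c\<in>C. l' c * M e' c) = l' c0 * M e' c0 + (\<Sum>c\<in>C - {c0}. l' c * M e' c)"
        using c0 insert.prems by (intro sum.remove) auto
      also have "(\<Sum>c\<in>C - {c0}. l' c * M e' c) = (\<Sum>c\<in>C - {c0}. l c * M e' c)"
        by (rule sum.cong) (auto simp: l'_def)
      finally show ?thesis by (simp add: l'_def)
    qed
    have "(\<Sum>c\<in>C. l' c * M e' c) = 0" if "e' \<in> insert e E" for e'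
    proof (cases "e' = e")
      case True
      then show ?thesis using c0 by (simp add: split s_def)
    next
      case False
      then have "(\<Sum>c\<in>C - {c0}. l c * M' e' c) = 0" using l that by blast
      moreover have "(\<Sum>c\<in>C - {c0}. l c * M' e' c)
          = (\<Sum>c\<in>C - {c0}. l c * M e' c) - s / M e c0 * M e' c0"
        unfolding M'_def s_def sum_divide_distrib sum_distrib_right right_diff_distrib sum_subtractf
        by (rule arg_cong2[of _ _ _ _ minus]) (auto intro!: sum.cong)
      ultimately show ?thesis by (simp add: split)
    qed
    moreover have "\<exists>c\<in>C. l' c \<noteq> 0"
      using l(1) by (auto simp: l'_def)
    ultimately show ?thesis by blast
  qed
qed

lemma countable_exponents: "countable (UNIV :: ('n::finite \<Rightarrow>\<^sub>0 nat) set)"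
proof -
  have "countable (range (lookup :: ('n \<Rightarrow>\<^sub>0 nat) \<Rightarrow> 'n \<Rightarrow> nat))"
    by (rule countableI_type)
  then show ?thesis
    by (rule countable_image_inj_on) (rule inj_lookup)
qed

text \<open>There are only countably many finite sets of exponents, so infinitely many \<open>h c\<close> have the same
  one and lie in a common finite-dimensional space.  This is where the Nullstellensatz below uses
  that the field is uncountable.\<close>

lemma uncountable_family_dependent:
  fixes h :: "complex \<Rightarrow> 'n::finite cpoly"
  shows "\<exists>F l. finite F \<and> (\<exists>c\<in>F. l c \<noteq> 0) \<and> (\<Sum>c\<in>F. cst (l c) * h c) = 0"
proof -
  have unc: "uncountable (UNIV :: complex set)"
  proof
    assume "countable (UNIV :: complex set)"
    then have "countable (range complex_of_real)" by (rule countable_subset[rotated]) simp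
    then have "countable (UNIV :: real set)"
      by (rule countable_image_inj_on) (auto simp: inj_on_def)
    then show False using uncountable_UNIV_real by simp
  qed
  have "countable {K :: ('n \<Rightarrow>\<^sub>0 nat) set. finite K}"
    using countable_Collect_finite_subset[OF countable_exponents] by simp
  then have "countable (range (\<lambda>c. keys (h c)))"
    by (rule countable_subset[rotated]) auto
  moreover have "(UNIV :: complex set) = (\<Union>K\<in>range (\<lambda>c. keys (h c)). {c. keys (h c) = K})" by auto
  ultimately have "\<exists>K\<in>range (\<lambda>c. keys (h c)). uncountable {c. keys (h c) = K}"
    using unc countable_UN[of "range (\<lambda>c. keys (h c))" "\<lambda>K. {c. keys (h c) = K}"] by fastforce
  then obtain K where "K \<in> range (\<lambda>c. keys (h c))" and "uncountable {c. keys (h c) = K}" by blast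
  then have K: "finite K" "infinite {c. keys (h c) = K}"
    using countable_finite by auto
  obtain F where F: "F \<subseteq> {c. keys (h c) = K}" "finite F" "card F = Suc (card K)"
    using infinite_arbitrarily_large[OF K(2), of "Suc (card K)"] by blast
  obtain l where l: "\<exists>c\<in>F. l c \<noteq> 0" "\<forall>t\<in>K. (\<Sum>c\<in>F. l c * lookup (h c) t) = 0"
    using homogeneous_system_solvable[of K F "\<lambda>t c. lookup (h c) t"] K F by auto
  have "(\<Sum>c\<in>F. cst (l c) * h c) = 0"
  proof (rule poly_mapping_eqI)
    fix t
    show "lookup (\<Sum>c\<in>F. cst (l c) * h c) t = lookup 0 t"
    proof (cases "t \<in> K")
      case True
      then show ?thesis using l by (simp add: lookup_sum)
    next
      case False
      then have "lookup (h c) t = 0" if "c \<in> F" for c using that F by (auto simp: in_keys_iff)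
      then show ?thesis by (simp add: lookup_sum)
    qed
  qed
  then show ?thesis using F l by blast
qed

definition is_ideal :: "'a::comm_ring_1 set \<Rightarrow> bool" where
  "is_ideal I \<longleftrightarrow> 0 \<in> I \<and> (\<forall>p\<in>I. \<forall>q\<in>I. p + q \<in> I) \<and> (\<forall>a. \<forall>p\<in>I. a * p \<in> I)"

lemma is_idealD:
  assumes "is_ideal I"
  shows "0 \<in> I" "p \<in> I \<Longrightarrow> q \<in> I \<Longrightarrow> p + q \<in> I" "p \<in> I \<Longrightarrow> a * p \<in> I"
  using assms unfolding is_ideal_def by auto

lemma is_ideal_sum:
  "is_ideal I \<Longrightarrow> (\<And>a. a \<in> A \<Longrightarrow> f a \<in> I) \<Longrightarrow> sum f A \<in> I"
  by (induction A rule: infinite_finite_induct) (auto intro: is_idealD)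

lemma is_ideal_ideal_gen: "is_ideal (ideal_gen g)"
  unfolding is_ideal_def using ideal_gen_0 ideal_gen_add ideal_gen_mult by blast

definition adjoin :: "'a::comm_ring_1 set \<Rightarrow> 'a \<Rightarrow> 'a set" where
  "adjoin I h = {p + c * h | p c. p \<in> I}"

lemma is_ideal_adjoin:
  assumes "is_ideal I"
  shows "is_ideal (adjoin I h)"
  unfolding is_ideal_def
proof (intro conjI ballI allI)
  have "0 = 0 + 0 * h" by simp
  then show "0 \<in> adjoin I h"
    unfolding adjoin_def using is_idealD(1)[OF assms] by blast
next
  fix p q
  assume "p \<in> adjoin I h" "q \<in> adjoin I h"
  then obtain p' c q' c' where "p = p' + c * h" "q = q' + c' * h" "p' \<in> I" "q' \<in> I"
    unfolding adjoin_def by auto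
  then have "p + q = (p' + q') + (c + c') * h" "p' + q' \<in> I"
    using is_idealD(2)[OF assms] by (auto simp: algebra_simps)
  then show "p + q \<in> adjoin I h" unfolding adjoin_def by blast
next
  fix a p
  assume "p \<in> adjoin I h"
  then obtain p' c where "p = p' + c * h" "p' \<in> I"
    unfolding adjoin_def by auto
  then have "a * p = a * p' + (a * c) * h" "a * p' \<in> I"
    using is_idealD(3)[OF assms, of p' a] by (auto simp: distrib_left mult.assoc)
  then show "a * p \<in> adjoin I h" unfolding adjoin_def by blast
qed

lemma adjoin_superset: "I \<subseteq> adjoin I h"
proof
  fix p assume "p \<in> I"
  moreover have "p = p + 0 * h" by simp
  ultimately show "p \<in> adjoin I h" unfolding adjoin_def by blast
qed

lemma adjoin_base: "is_ideal I \<Longrightarrow> h \<in> adjoin I h"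
proof -
  assume "is_ideal I"
  then have "0 \<in> I" by (rule is_idealD)
  moreover have "h = 0 + 1 * h" by simp
  ultimately show ?thesis unfolding adjoin_def by blast
qed

definition poly_at :: "'v \<Rightarrow> complex poly \<Rightarrow> 'v cpoly" where
  "poly_at i p = poly (map_poly cst p) (var i)"

lemma poly_at_pCons [simp]: "poly_at i (pCons a p) = cst a + var i * poly_at i p"
  by (simp add: poly_at_def map_poly_pCons)

lemma poly_at_0 [simp]: "poly_at i 0 = 0"
  by (simp add: poly_at_def)

lemma poly_at_1 [simp]: "poly_at i 1 = 1"
  by (simp add: one_pCons)

lemma poly_at_add: "poly_at i (p + q) = poly_at i p + poly_at i q"
  by (induction p q rule: poly_induct2) (simp_all add: cst_add algebra_simps)

lemma poly_at_smult: "poly_at i (smult a p) = cst a * poly_at i p"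
  by (induction p) (simp_all add: cst_mult algebra_simps)

lemma poly_at_mult: "poly_at i (p * q) = poly_at i p * poly_at i q"
  by (induction p) (simp_all add: poly_at_add poly_at_smult algebra_simps)

lemma poly_at_sum: "poly_at i (sum f A) = (\<Sum>a\<in>A. poly_at i (f a))"
  by (induction A rule: infinite_finite_induct) (simp_all add: poly_at_add)

lemma poly_at_prod: "poly_at i (prod f A) = (\<Prod>a\<in>A. poly_at i (f a))"
  by (induction A rule: infinite_finite_induct) (simp_all add: poly_at_mult)

text \<open>If every \<open>x\<^sub>i - c\<close> is invertible modulo \<open>I\<close>, then so is every non-zero polynomial in \<open>x\<^sub>i\<close>,
  since it splits into linear factors.\<close>

lemma poly_at_in_ideal_imp_1:
  assumes I: "is_ideal I" and ex: "\<And>c. \<exists>u\<in>I. \<exists>h. 1 = u + h * (var i - cst c)"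
    and "p \<noteq> 0" "poly_at i p \<in> I"
  shows "1 \<in> I"
  using assms(3,4)
proof (induction "degree p" arbitrary: p rule: less_induct)
  case less
  show ?case
  proof (cases "degree p = 0")
    case True
    then obtain a where a: "p = [:a:]" by (rule degree_eq_zeroE)
    then have "a \<noteq> 0" "cst a \<in> I" using less.prems by auto
    then have "cst (1 / a) * cst a \<in> I" using is_idealD(3)[OF I] by blast
    then show ?thesis using \<open>a \<noteq> 0\<close> by (simp add: cst_mult[symmetric])
  next
    case False
    then have "\<not> constant (poly p)" by (simp add: constant_degree)
    then obtain r where "poly p r = 0" using fundamental_theorem_of_algebra by blast
    then obtain q where q: "p = [:- r, 1:] * q" by (auto simp: poly_eq_0_iff_dvd elim: dvdE)
    have "q \<noteq> 0" using less.prems q by auto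
    then have "degree q < degree p" unfolding q by (subst degree_mult_eq) auto
    obtain u h where u: "u \<in> I" "1 = u + h * (var i - cst r)" using ex by blast
    have p_eq: "poly_at i p = (var i - cst r) * poly_at i q"
      unfolding q poly_at_mult by (simp add: cst_uminus)
    have "poly_at i q * u + h * poly_at i p = poly_at i q * (u + h * (var i - cst r))"
      unfolding p_eq by (simp add: algebra_simps)
    then have "poly_at i q = poly_at i q * u + h * poly_at i p" using u(2) by simp
    also have "\<dots> \<in> I" by (intro is_idealD(2,3)[OF I] less.prems u(1))
    finally show ?thesis using less.hyps \<open>degree q < degree p\<close> \<open>q \<noteq> 0\<close> by blast
  qed
qed

text \<open>Otherwise each \<open>x\<^sub>i - c\<close> has an inverse \<open>h\<^sub>c\<close> modulo \<open>I\<close>.  A linear relation among the \<open>h\<^sub>c\<close>,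
  multiplied by the product of the \<open>x\<^sub>i - c\<close> that occur in it, becomes a polynomial \<open>P\<close> in \<open>x\<^sub>i\<close> that
  lies in \<open>I\<close>.\<close>

lemma proper_ideal_specialize:
  fixes I :: "'n::finite cpoly set"
  assumes I: "is_ideal I" and "1 \<notin> I"
  shows "\<exists>c. 1 \<notin> adjoin I (var i - cst c)"
proof (rule ccontr)
  assume "\<nexists>c. 1 \<notin> adjoin I (var i - cst c)"
  then have in_adjoin: "1 \<in> adjoin I (var i - cst c)" for c by blast
  have ex: "\<exists>u\<in>I. \<exists>h. 1 = u + h * (var i - cst c)" for c
    using in_adjoin[of c] unfolding adjoin_def by blast
  have "\<exists>uh. fst uh \<in> I \<and> 1 = fst uh + snd uh * (var i - cst c)" for c
    using ex[of c] by (metis fst_conv snd_conv)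
  then obtain uh where uh: "\<And>c. fst (uh c) \<in> I \<and> 1 = fst (uh c) + snd (uh c) * (var i - cst c)"
    using choice[of "\<lambda>c uh. fst uh \<in> I \<and> 1 = fst uh + snd uh * (var i - cst c)"] by blast
  define u h where "u = (\<lambda>c. fst (uh c))" and "h = (\<lambda>c. snd (uh c))"
  have u: "u c \<in> I" and uh: "1 = u c + h c * (var i - cst c)" for c
    using uh[of c] unfolding u_def h_def by blast+
  obtain F l where F: "finite F" "\<exists>c\<in>F. l c \<noteq> 0" "(\<Sum>c\<in>F. cst (l c) * h c) = 0"
    using uncountable_family_dependent by blast
  define P where "P = (\<Sum>c\<in>F. smult (l c) (\<Prod>c'\<in>F - {c}. [:- c', 1:]))"
  define R where "R = (\<lambda>A. \<Prod>c'\<in>A. (var i :: 'n cpoly) - cst c')"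
  obtain c0 where c0: "c0 \<in> F" "l c0 \<noteq> 0" using F by blast
  \<comment> \<open>Only the summand of \<open>c0\<close> survives at \<open>c0\<close>, so \<open>P\<close> is not zero.\<close>
  have "poly P c0 = (\<Sum>c\<in>F. l c * (\<Prod>c'\<in>F - {c}. c0 - c'))"
    by (simp add: P_def poly_sum poly_prod)
  also have "\<dots> = (\<Sum>c\<in>F. if c = c0 then l c0 * (\<Prod>c'\<in>F - {c0}. c0 - c') else 0)"
  proof (rule sum.cong[OF refl])
    fix c assume "c \<in> F"
    show "l c * (\<Prod>c'\<in>F - {c}. c0 - c') = (if c = c0 then l c0 * (\<Prod>c'\<in>F - {c0}. c0 - c') else 0)"
      using F(1) c0(1) by auto
  qed
  also have "\<dots> \<noteq> 0" using F(1) c0 by auto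
  finally have "P \<noteq> 0" by auto
  have R_split: "R F = (var i - cst c) * R (F - {c})" if "c \<in> F" for c
    unfolding R_def using F(1) that by (rule prod.remove)
  have "poly_at i P = (\<Sum>c\<in>F. cst (l c) * R (F - {c}))"
    by (simp add: P_def R_def poly_at_sum poly_at_smult poly_at_prod cst_uminus)
  also have "\<dots> = (\<Sum>c\<in>F. (cst (l c) * R (F - {c})) * u c + R F * (cst (l c) * h c))"
  proof (rule sum.cong[OF refl])
    fix c assume c: "c \<in> F"
    have "cst (l c) * R (F - {c}) = cst (l c) * R (F - {c}) * (u c + h c * (var i - cst c))"
      using uh[of c] by simp
    also have "\<dots> = (cst (l c) * R (F - {c})) * u c + ((var i - cst c) * R (F - {c})) * (cst (l c) * h c)"
      by (simp only: algebra_simps)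
    finally show "cst (l c) * R (F - {c}) = (cst (l c) * R (F - {c})) * u c + R F * (cst (l c) * h c)"
      using R_split[OF c] by simp
  qed
  also have "\<dots> = (\<Sum>c\<in>F. (cst (l c) * R (F - {c})) * u c)"
    using F(3) by (simp add: sum.distrib sum_distrib_left[symmetric])
  also have "\<dots> \<in> I" by (intro is_ideal_sum[OF I] is_idealD(3)[OF I] u)
  finally have "1 \<in> I" using poly_at_in_ideal_imp_1[OF I ex \<open>P \<noteq> 0\<close>] by blast
  then show False using assms by blast
qed

lemma single_eq_prod: "single t c = cst c * (\<Prod>i\<in>UNIV. var i ^ lookup t i)" for t :: "'n::finite \<Rightarrow>\<^sub>0 nat"
proof -
  have "single t c - cst c * (\<Prod>i\<in>UNIV. var i ^ lookup t i) = 0"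
    by (rule poly_eval_eq_0_imp)
       (simp add: poly_eval_diff poly_eval_mult poly_eval_prod poly_eval_power poly_eval_single
         mono_val_superset[of UNIV])
  then show ?thesis by simp
qed

lemma cpoly_induct [case_names cst var add mult]:
  fixes p :: "'n::finite cpoly"
  assumes "\<And>c. P (cst c)" and "\<And>i. P (var i)"
    and "\<And>p q. P p \<Longrightarrow> P q \<Longrightarrow> P (p + q)" and "\<And>p q. P p \<Longrightarrow> P q \<Longrightarrow> P (p * q)"
  shows "P p"
proof (induction p rule: poly_mapping_monomial_induct)
  case (single t c)
  have one: "P 1" using assms(1)[of 1] by simp
  have power: "P (q ^ k)" if "P q" for q k
    by (induction k) (use that one assms(4) in auto)
  have "P (\<Prod>i\<in>A. var i ^ lookup t i)" if "finite A" for A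
    using that by (induction A rule: finite_induct) (use one power assms(2,4) in auto)
  then show ?case unfolding single_eq_prod using assms(1,4) by auto
qed (rule assms(3))

text \<open>Specializing one variable after the other keeps the ideal proper.  The final ideal contains
  \<open>x\<^sub>i - z\<^sub>i\<close> for all \<open>i\<close>, hence every polynomial is congruent to its value at \<open>z\<close>.\<close>

lemma weak_nullstellensatz:
  fixes I :: "'n::finite cpoly set"
  assumes "is_ideal I" and "1 \<notin> I"
  shows "\<exists>z. \<forall>p\<in>I. poly_eval z p = 0"
proof -
  have "\<exists>I'. is_ideal I' \<and> 1 \<notin> I' \<and> I \<subseteq> I' \<and> (\<forall>i\<in>A. \<exists>c. var i - cst c \<in> I')" if "finite A" for A :: "'n set"
    using that
  proof (induction A rule: finite_induct)
    case empty
    then show ?case using assms by blast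
  next
    case (insert i A)
    then obtain I' where I': "is_ideal I'" "1 \<notin> I'" "I \<subseteq> I'" "\<forall>i\<in>A. \<exists>c. var i - cst c \<in> I'" by blast
    obtain c where c: "1 \<notin> adjoin I' (var i - cst c)" using proper_ideal_specialize I' by blast
    show ?case
      using is_ideal_adjoin[OF I'(1)] c I' adjoin_superset[of I'] adjoin_base[OF I'(1)]
      by (intro exI[of _ "adjoin I' (var i - cst c)"]) blast
  qed
  from this[of UNIV] obtain I' where I': "is_ideal I'" "1 \<notin> I'" "I \<subseteq> I'" "\<forall>i. \<exists>c. var i - cst c \<in> I'"
    by auto
  then obtain z where z: "\<And>i. var i - cst (z i) \<in> I'" by metis
  have eq: "p - cst (poly_eval z p) \<in> I'" for p
  proof (induction p rule: cpoly_induct)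
    case (add p q)
    then have "(p - cst (poly_eval z p)) + (q - cst (poly_eval z q)) \<in> I'"
      using is_idealD(2)[OF I'(1)] by blast
    then show ?case by (simp add: poly_eval_add cst_add algebra_simps)
  next
    case (mult p q)
    then have "q * (p - cst (poly_eval z p)) + cst (poly_eval z p) * (q - cst (poly_eval z q)) \<in> I'"
      using is_idealD(2,3)[OF I'(1)] by blast
    then show ?case by (simp add: poly_eval_mult cst_mult algebra_simps)
  qed (use z is_idealD(1)[OF I'(1)] in auto)
  have "poly_eval z p = 0" if "p \<in> I" for p
  proof (rule ccontr)
    let ?c = "poly_eval z p"
    assume c: "?c \<noteq> 0"
    have "cst (1 / ?c) * (p + (- 1) * (p - cst ?c)) \<in> I'"
      using is_idealD(2,3)[OF I'(1)] eq[of p] that I'(3) by blast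
    moreover have "cst (1 / ?c) * (p + (- 1) * (p - cst ?c)) = 1"
      using c by (simp add: cst_mult[symmetric])
    ultimately show False using I'(2) by simp
  qed
  then show ?thesis by blast
qed

text \<open>The \<open>g\<^sub>j\<close> and \<open>x\<^sub>i - 1\<close> have no common zero, so \<open>1 = p + c (x\<^sub>i - 1)\<close> with \<open>p\<close> in the ideal \<open>(g)\<close>.
  This ideal is graded; comparing homogeneous components shows that \<open>x\<^sub>i\<^sup>m\<close> is congruent to minus
  the component of \<open>c\<close> of degree \<open>m\<close>, which vanishes for some \<open>m\<close>.\<close>

lemma power_in_ideal_gen:
  fixes g :: "'n::finite \<Rightarrow> 'n cpoly"
  assumes g: "\<And>j. g j \<in> forms e"
    and zero: "\<And>v :: complex ^ 'n. (\<And>j. poly_eval (($) v) (g j) = 0) \<Longrightarrow> v = 0"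
  shows "\<exists>N\<ge>1. \<forall>i. var i ^ N \<in> ideal_gen g"
proof -
  have "\<exists>N. var i ^ N \<in> ideal_gen g" for i
  proof -
    let ?I = "adjoin (ideal_gen g) (var i - 1)"
    have "1 \<in> ?I"
    proof (rule ccontr)
      assume "1 \<notin> ?I"
      then obtain z where z: "\<forall>p\<in>?I. poly_eval z p = 0"
        using weak_nullstellensatz is_ideal_adjoin is_ideal_ideal_gen by blast
      have zv: "($) (\<chi> i. z i) = z" by auto
      have "(\<chi> i. z i) = 0"
      proof (rule zero)
        fix j
        have "g j \<in> ?I" using adjoin_superset ideal_gen_base by blast
        then show "poly_eval (($) (\<chi> i. z i)) (g j) = 0" using z by (simp add: zv)
      qed
      then have "z i = 0" by (metis vec_lambda_beta zero_index)
      moreover have "var i - 1 \<in> ?I" using adjoin_base is_ideal_ideal_gen by blast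
      then have "z i = 1" using z by (auto simp: poly_eval_diff)
      ultimately show False by simp
    qed
    then obtain p c where pc: "1 = p + c * (var i - 1)" "p \<in> ideal_gen g"
      unfolding adjoin_def by auto
    have p: "p = 1 + c - c * var i" using pc(1) by (simp add: algebra_simps)
    have comp: "hcomp m p \<in> ideal_gen g" for m by (rule ideal_gen_hcomp[OF g pc(2)])
    have "var i ^ m + hcomp m c \<in> ideal_gen g" for m
    proof (induction m)
      case 0
      have "hcomp 0 (c * var i) = 0" by (rule hcomp_mult_form(2)[OF forms_var]) simp
      then show ?case using comp[of 0] unfolding p
        by (simp add: hcomp_diff hcomp_add hcomp_of_form[OF forms_1])
    next
      case (Suc m)
      have "hcomp (Suc m) c - hcomp m c * var i \<in> ideal_gen g"
        using comp[of "Suc m"] unfolding p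
        by (simp add: hcomp_diff hcomp_add hcomp_of_form[OF forms_1] hcomp_var_mult)
      from ideal_gen_add[OF this ideal_gen_mult[OF Suc, of "var i"]] show ?case
        by (simp add: algebra_simps)
    qed
    moreover obtain m where "hcomp m c = 0" using hcomp_eventually_0 by blast
    ultimately show ?thesis by (metis add.right_neutral)
  qed
  then obtain N where N: "\<And>i. var i ^ N i \<in> ideal_gen g" by metis
  define M where "M = Suc (\<Sum>i\<in>UNIV. N i)"
  have "var i ^ M \<in> ideal_gen g" for i
  proof -
    have "N i \<le> M" unfolding M_def using member_le_sum[of i UNIV N] by simp
    then have "var i ^ M = var i ^ (M - N i) * var i ^ N i" by (simp flip: power_add)
    then show ?thesis using ideal_gen_mult[OF N] by simp
  qed
  then show ?thesis by (intro exI[of _ M]) (simp add: M_def)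
qed

section \<open>Determinants over commutative rings\<close>

lemma det_hom:
  fixes h :: "'a::comm_ring_1 \<Rightarrow> 'b::comm_ring_1" and A :: "'a ^ 'n ^ 'n"
  assumes add: "\<And>p q. h (p + q) = h p + h q" and mult: "\<And>p q. h (p * q) = h p * h q"
    and one: "h 1 = 1"
  shows "h (det A) = det (\<chi> i j. h (A $ i $ j))"
proof -
  have zero: "h 0 = 0" using add[of 0 0] by simp
  have minus: "h (- p) = - h p" for p
    using add[of p "- p"] zero by (simp add: eq_neg_iff_add_eq_0 add.commute)
  have "h (sum f S) = (\<Sum>a\<in>S. h (f a))" for f and S :: "('n \<Rightarrow> 'n) set"
    by (induction S rule: infinite_finite_induct) (simp_all add: zero add)
  moreover have "h (prod f S) = (\<Prod>a\<in>S. h (f a))" for f and S :: "'n set"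
    by (induction S rule: infinite_finite_induct) (simp_all add: one mult)
  moreover have "h (of_int (sign p)) = of_int (sign p)" for p :: "'n \<Rightarrow> 'n"
    by (simp add: sign_def one minus)
  ultimately show ?thesis by (simp add: det_def mult)
qed

lemma poly_eval_det:
  "poly_eval x (det A) = det (\<chi> i j. poly_eval x (A $ i $ j))"
  by (rule det_hom) (simp_all add: poly_eval_add poly_eval_mult)

lemma det_row_in_ideal:
  fixes M :: "'a::comm_ring_1 ^ 'n ^ 'n"
  assumes I: "is_ideal I" and row: "\<And>j. M $ k $ j \<in> I"
  shows "det M \<in> I"
  unfolding det_def
proof (intro is_ideal_sum[OF I] is_idealD(3)[OF I])
  fix p :: "'n \<Rightarrow> 'n"
  have "(\<Prod>i\<in>UNIV. M $ i $ p i) = (\<Prod>i\<in>UNIV - {k}. M $ i $ p i) * M $ k $ p k"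
    by (simp add: prod.remove[of UNIV k] mult.commute)
  also have "\<dots> \<in> I" using is_idealD(3)[OF I] row by blast
  finally show "(\<Prod>i\<in>UNIV. M $ i $ p i) \<in> I" .
qed

text \<open>Cramer's rule: replacing column \<open>k\<close> of \<open>A\<close> by \<open>A x\<close> multiplies the determinant by
  \<open>x\<^sub>k\<close>.\<close>

lemma cramer_in_ideal:
  fixes A :: "'a::comm_ring_1 ^ 'n ^ 'n" and x :: "'a ^ 'n"
  assumes I: "is_ideal I" and Ax: "\<And>i. (A *v x) $ i \<in> I"
  shows "x $ k * det A \<in> I"
proof -
  define B where "B = transpose A"
  have "det (\<chi> i. if i = k then \<Sum>j\<in>UNIV. x $ j *s (B $ j) else B $ i)
      = (\<Sum>j\<in>UNIV. det (\<chi> i. if i = k then x $ j *s (B $ j) else B $ i))"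
    using det_linear_row_sum[of UNIV k "\<lambda>_ j. x $ j *s (B $ j)" "($) B"] by simp
  also have "\<dots> = (\<Sum>j\<in>UNIV. x $ j * det (\<chi> i. if i = k then B $ j else B $ i))"
    by (rule sum.cong[OF refl]) (rule det_row_mul)
  also have "\<dots> = (\<Sum>j\<in>UNIV. if j = k then x $ k * det B else 0)"
  proof (rule sum.cong[OF refl])
    fix j
    show "x $ j * det (\<chi> i. if i = k then B $ j else B $ i) = (if j = k then x $ k * det B else 0)"
    proof (cases "j = k")
      case True
      then have "(\<chi> i. if i = k then B $ j else B $ i) = B" by (simp add: vec_eq_iff)
      then show ?thesis using True by simp
    next
      case False
      then have "det (\<chi> i. if i = k then B $ j else B $ i) = 0"
        by (intro det_identical_rows[of k j]) (auto simp: row_def vec_eq_iff)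
      then show ?thesis using False by simp
    qed
  qed
  also have "\<dots> = x $ k * det A" by (simp add: B_def)
  finally have eq: "det (\<chi> i. if i = k then \<Sum>j\<in>UNIV. x $ j *s (B $ j) else B $ i) = x $ k * det A" .
  show ?thesis unfolding eq[symmetric]
  proof (rule det_row_in_ideal[OF I])
    fix i
    show "(\<chi> i. if i = k then \<Sum>j\<in>UNIV. x $ j *s (B $ j) else B $ i) $ k $ i \<in> I"
      using Ax[of i] by (simp add: B_def transpose_def matrix_vector_mult_def mult.commute)
  qed
qed

section \<open>The socle of a zero-dimensional complete intersection\<close>

text \<open>The ideal generated by the \<open>N\<close>-th powers of the variables in \<open>K\<close>, described by its monomials
  so that membership can be refuted by looking at one coefficient.\<close>

definition box_ideal :: "nat \<Rightarrow> 'n set \<Rightarrow> 'n::finite cpoly set" where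
  "box_ideal N K = {p. \<forall>t. (\<forall>k\<in>K. lookup t k < N) \<longrightarrow> lookup p t = 0}"

lemma is_ideal_box_ideal: "is_ideal (box_ideal N K)"
  unfolding is_ideal_def
proof (intro conjI ballI allI)
  fix a p
  assume p: "p \<in> box_ideal N K"
  show "a * p \<in> box_ideal N K"
  proof (induction a rule: poly_mapping_monomial_induct)
    case (single s b)
    have "lookup (single s b * p) t = 0" if t: "\<forall>k\<in>K. lookup t k < N" for t
    proof (cases "\<exists>i. lookup t i < lookup s i")
      case True
      then obtain i where "lookup t i < lookup s i" by blast
      then show ?thesis by (rule lookup_single_mult_other)
    next
      case False
      then have "t = s + (t - s)" by (intro exp_le_add_diff) (simp add: not_less)
      then have "lookup (single s b * p) t = b * lookup p (t - s)"
        using lookup_single_mult_add[of s b p "t - s"] by simp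
      moreover have "\<forall>k\<in>K. lookup (t - s) k < N"
        using t by (auto simp: lookup_minus intro: le_less_trans[OF diff_le_self])
      ultimately show ?thesis using p by (simp add: box_ideal_def)
    qed
    then show ?case by (simp add: box_ideal_def)
  next
    case (add p q)
    then show ?case by (simp add: box_ideal_def distrib_right lookup_add)
  qed
qed (auto simp: box_ideal_def lookup_add)

lemma var_power: "var i ^ k = single (single i k) 1"
proof (induction k)
  case (Suc k)
  then show ?case by (simp add: var_def mult_single flip: single_add)
qed simp

lemma var_power_box_ideal: "k \<in> K \<Longrightarrow> var k ^ N \<in> box_ideal N K"
  by (auto simp: box_ideal_def var_power lookup_single when_def)

lift_definition const_exp :: "nat \<Rightarrow> 'n::finite \<Rightarrow>\<^sub>0 nat" is "\<lambda>k _. k"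
  by simp

lemma lookup_const_exp [simp]: "lookup (const_exp k) i = k"
  by transfer simp

text \<open>The claim is clear for the diagonal matrix \<open>E\<close> with entries \<open>x\<^sub>i\<^sup>N\<^sup>-\<^sup>1\<close>, and \<open>C\<close> can be turned
  into \<open>E\<close> row by row.  Exchanging row \<open>i\<close> changes the determinant by \<open>det D\<close>, where \<open>D x\<close> has
  \<open>i\<close>-th entry \<open>0\<close> and its other entries are \<open>x\<^sub>k\<^sup>N\<close>.  By Cramer's rule \<open>x\<^sub>i det D\<close> lies in the ideal of
  the powers of the variables other than \<open>x\<^sub>i\<close>, so the coefficient in question of \<open>det D\<close> is \<open>0\<close>.\<close>

lemma det_coeff_corner:
  fixes C :: "'n::finite cpoly ^ 'n ^ 'n"
  assumes "N \<ge> 1" and Cx: "\<And>i. (\<Sum>j\<in>UNIV. C $ i $ j * var j) = var i ^ N"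
  shows "lookup (det C) (const_exp (N - 1)) = 1"
proof -
  let ?m = "const_exp (N - 1) :: 'n \<Rightarrow>\<^sub>0 nat"
  define E :: "'n cpoly ^ 'n ^ 'n" where "E = (\<chi> i j. if i = j then var i ^ (N - 1) else 0)"
  have Ex: "(\<Sum>j\<in>UNIV. E $ i $ j * var j) = var i ^ N" for i
  proof -
    have "(\<Sum>j\<in>UNIV. E $ i $ j * var j) = (\<Sum>j\<in>UNIV. if i = j then var i ^ (N - 1) * var i else 0)"
      unfolding E_def by (rule sum.cong) auto
    also have "\<dots> = var i ^ N" using power_minus_mult[of N "var i"] assms(1) by simp
    finally show ?thesis .
  qed
  define CF where "CF = (\<lambda>F. \<chi> i. if i \<in> F then E $ i else C $ i)"
  have CFx: "(\<Sum>j\<in>UNIV. CF F $ i $ j * var j) = var i ^ N" for F i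
    unfolding CF_def using Ex Cx by simp
  have "lookup (det (CF F)) ?m = lookup (det C) ?m" if "finite F" for F
    using that
  proof (induction F rule: finite_induct)
    case empty
    have "CF {} = C" by (simp add: CF_def vec_eq_iff)
    then show ?case by simp
  next
    case (insert i F)
    define D where "D = (\<chi> k. if k = i then C $ k - E $ k else CF F $ k)"
    have c1: "CF F = (\<chi> k. if k = i then (C $ k - E $ k) + E $ k else CF F $ k)"
      using insert.hyps by (simp add: CF_def vec_eq_iff)
    have c2: "CF (insert i F) = (\<chi> k. if k = i then E $ k else CF F $ k)"
      by (simp add: CF_def vec_eq_iff)
    have "det (CF F) = det D + det (CF (insert i F))"
      by (subst c1, subst det_row_add) (simp only: D_def c2)
    moreover have "lookup (det D) ?m = 0"
    proof -
      let ?x = "(\<chi> j. var j) :: 'n cpoly ^ 'n"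
      let ?I = "box_ideal N (- {i})"
      have "(D *v ?x) $ k \<in> ?I" for k
      proof (cases "k = i")
        case True
        have "(D *v ?x) $ k = (\<Sum>j\<in>UNIV. C $ k $ j * var j) - (\<Sum>j\<in>UNIV. E $ k $ j * var j)"
          using True by (simp add: D_def matrix_vector_mult_def left_diff_distrib sum_subtractf)
        then show ?thesis using is_idealD(1)[OF is_ideal_box_ideal] by (simp add: Cx Ex)
      next
        case False
        then have "(D *v ?x) $ k = var k ^ N"
          using CFx[of F k] by (simp add: D_def matrix_vector_mult_def)
        then show ?thesis using False by (simp add: var_power_box_ideal)
      qed
      then have "?x $ i * det D \<in> ?I" by (rule cramer_in_ideal[OF is_ideal_box_ideal])
      then have "var i * det D \<in> ?I" by simp
      moreover have "\<forall>k\<in>- {i}. lookup (?m + unit_exp i) k < N"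
        using assms(1) by (simp add: lookup_add lookup_single when_def)
      ultimately have "lookup (var i * det D) (?m + unit_exp i) = 0"
        unfolding box_ideal_def by blast
      then show ?thesis by (simp add: lookup_var_mult lookup_add)
    qed
    ultimately show ?case using insert.IH by (simp add: lookup_add)
  qed
  then have "lookup (det C) ?m = lookup (det (CF UNIV)) ?m" by simp
  also have "det (CF UNIV) = (\<Prod>i\<in>UNIV. CF UNIV $ i $ i)"
    by (rule det_diagonal) (simp add: CF_def E_def)
  also have "\<dots> = single ?m 1"
    unfolding single_eq_prod by (simp add: CF_def E_def)
  finally show ?thesis by simp
qed

lemma lookup_mult_0:
  fixes p q :: "('v \<Rightarrow>\<^sub>0 nat) \<Rightarrow>\<^sub>0 'b::comm_ring_1"
  shows "lookup (p * q) 0 = lookup p 0 * lookup q 0"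
proof (rule additive_multiplicative)
  fix s t :: "'v \<Rightarrow>\<^sub>0 nat" and a b :: 'b
  have "s + t = 0 \<longleftrightarrow> s = 0 \<and> t = 0"
    by (auto simp: poly_mapping_eq_iff lookup_add fun_eq_iff simp del: lookup_inject)
  then show "lookup (single s a * single t b) 0 = lookup (single s a) 0 * lookup (single t b) 0"
    by (auto simp: mult_single lookup_single when_def)
qed (rule lookup_add)

lemma lookup_map_0: "f 0 = 0 \<Longrightarrow> lookup (Poly_Mapping.map f p) t = f (lookup p t)"
  by (cases "lookup p t = 0") (simp_all add: Poly_Mapping.map.rep_eq)

text \<open>Two sets of variables: an element of \<open>'n cpoly2\<close> is a polynomial in \<open>y\<close> whose coefficients
  are polynomials in \<open>x\<close>.\<close>

type_synonym 'n cpoly2 = "('n \<Rightarrow>\<^sub>0 nat) \<Rightarrow>\<^sub>0 'n cpoly"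

definition in_x :: "'n cpoly \<Rightarrow> 'n cpoly2" where "in_x p = single 0 p"

definition in_y :: "'n cpoly \<Rightarrow> 'n cpoly2" where "in_y p = Poly_Mapping.map cst p"

lemma in_x_add: "in_x (p + q) = in_x p + in_x q"
  by (simp add: in_x_def single_add)

lemma in_x_mult: "in_x (p * q) = in_x p * in_x q"
  by (simp add: in_x_def mult_single)

lemma lookup_in_x_mult: "lookup (in_x h * P) t = h * lookup P t"
  using lookup_single_mult_add[of 0 h P t] by (simp add: in_x_def)

lemma lookup_in_y: "lookup (in_y p) t = cst (lookup p t)"
  by (simp add: in_y_def lookup_map_0)

lemma in_y_single: "in_y (single t c) = single t (cst c)"
  by (rule poly_mapping_eqI) (simp add: lookup_in_y lookup_single when_def)

lemma in_y_add: "in_y (p + q) = in_y p + in_y q"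
  by (rule poly_mapping_eqI) (simp add: lookup_in_y lookup_add cst_add)

lemma in_y_mult: "in_y (p * q) = in_y p * in_y q"
  by (rule additive_multiplicative) (simp_all add: in_y_add in_y_single mult_single cst_mult)

lemma in_x_minus_in_y:
  fixes p :: "'n::finite cpoly"
  shows "in_x p - in_y p \<in> ideal_gen (\<lambda>j. in_x (var j) - in_y (var j))" (is "_ \<in> ?I")
proof (induction p rule: cpoly_induct)
  case (cst c)
  have "in_x (cst c) = in_y (cst c :: 'n cpoly)"
    by (rule poly_mapping_eqI) (simp add: in_x_def cst_def in_y_single)
  then show ?case by (simp add: ideal_gen_0)
next
  case (var i)
  then show ?case by (rule ideal_gen_base)
next
  case (add p q)
  from ideal_gen_add[OF this] show ?case by (simp add: in_x_add in_y_add algebra_simps)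
next
  case (mult p q)
  have "in_x p * (in_x q - in_y q) + in_y q * (in_x p - in_y p) \<in> ?I"
    by (intro ideal_gen_add ideal_gen_mult mult)
  then show ?case by (simp add: in_x_mult in_y_mult algebra_simps)
qed

text \<open>The functional acts on the coefficients, that is on \<open>x\<close>, and leaves \<open>y\<close> alone.\<close>

definition apply_x :: "('n cpoly \<Rightarrow> complex) \<Rightarrow> 'n cpoly2 \<Rightarrow> 'n cpoly" where
  "apply_x l P = Poly_Mapping.map l P"

definition linear_functional :: "('n cpoly \<Rightarrow> complex) \<Rightarrow> bool" where
  "linear_functional l \<longleftrightarrow> (\<forall>p q. l (p + q) = l p + l q) \<and> (\<forall>c p. l (cst c * p) = c * l p)"

lemma linear_functionalD:
  assumes "linear_functional l"
  shows "l (p + q) = l p + l q" "l (cst c * p) = c * l p" "l 0 = 0" "l (- p) = - l p"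
    "l (p - q) = l p - l q" "l (sum f A) = (\<Sum>a\<in>A. l (f a))"
proof -
  have add: "l (p + q) = l p + l q" and scale: "l (cst c * p) = c * l p" for p q c
    using assms by (auto simp: linear_functional_def)
  show "l (p + q) = l p + l q" "l (cst c * p) = c * l p" by (fact add scale)+
  show zero: "l 0 = 0" using scale[of 0 0] by simp
  have minus: "l (- p) = - l p" for p using scale[of "- 1" p] by (simp add: cst_uminus)
  show "l (- p) = - l p" by (fact minus)
  show "l (p - q) = l p - l q" using add[of p "- q"] minus by simp
  show "l (sum f A) = (\<Sum>a\<in>A. l (f a))"
    by (induction A rule: infinite_finite_induct) (simp_all add: zero add)
qed

context
  fixes l :: "'n::finite cpoly \<Rightarrow> complex"
  assumes l: "linear_functional l"
begin

lemma lookup_apply_x: "lookup (apply_x l P) t = l (lookup P t)"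
  by (simp add: apply_x_def lookup_map_0 linear_functionalD(3)[OF l])

lemma apply_x_add: "apply_x l (P + Q) = apply_x l P + apply_x l Q"
  by (rule poly_mapping_eqI) (simp add: lookup_apply_x lookup_add linear_functionalD(1)[OF l])

lemma apply_x_diff: "apply_x l (P - Q) = apply_x l P - apply_x l Q"
  by (rule poly_mapping_eqI) (simp add: lookup_apply_x lookup_minus linear_functionalD(5)[OF l])

lemma apply_x_sum: "apply_x l (sum f A) = (\<Sum>a\<in>A. apply_x l (f a))"
  by (rule poly_mapping_eqI) (simp add: lookup_apply_x lookup_sum linear_functionalD(6)[OF l])

lemma apply_x_in_y_mult: "apply_x l (in_y q * P) = q * apply_x l P"
proof (induction q rule: poly_mapping_monomial_induct)
  case (single s a)
  show ?case unfolding in_y_single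
  proof (rule poly_mapping_eqI)
    fix t
    show "lookup (apply_x l (single s (cst a) * P)) t = lookup (single s a * apply_x l P) t"
    proof (cases "\<exists>i. lookup t i < lookup s i")
      case True
      then obtain i where "lookup t i < lookup s i" by blast
      then show ?thesis
        by (simp add: lookup_apply_x lookup_single_mult_other[of t i s] linear_functionalD(3)[OF l])
    next
      case False
      then have "t = s + (t - s)" by (intro exp_le_add_diff) (simp add: not_less)
      then show ?thesis
        using lookup_single_mult_add[of s "cst a" P "t - s"]
          lookup_single_mult_add[of s a "apply_x l P" "t - s"]
        by (simp add: lookup_apply_x linear_functionalD(2)[OF l])
    qed
  qed
next
  case (add p q)
  then show ?case by (simp add: in_y_add distrib_right apply_x_add)
qed

end

text \<open>The variables annihilate \<open>p\<close> modulo the ideal, so only the constant term of \<open>q\<close> acts.\<close>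

lemma socle_mult:
  fixes p q :: "'n::finite cpoly"
  assumes "\<And>i. var i * p \<in> ideal_gen g"
  shows "p * q - cst (lookup q 0) * p \<in> ideal_gen g"
proof (induction q rule: cpoly_induct)
  case (cst c)
  have "lookup (cst c :: 'n cpoly) 0 = c" by (simp add: cst_def)
  then show ?case by (simp add: ideal_gen_0 mult.commute)
next
  case (var i)
  have "lookup (var i :: 'n cpoly) 0 = 0" using lookup_var_mult[of i 1 0] by simp
  then show ?case using assms[of i] by (simp add: mult.commute)
next
  case (add q q')
  from ideal_gen_add[OF this] show ?case by (simp add: lookup_add cst_add algebra_simps)
next
  case (mult q q')
  have "q' * (p * q - cst (lookup q 0) * p) + cst (lookup q 0) * (p * q' - cst (lookup q' 0) * p)
      \<in> ideal_gen g"
    by (intro ideal_gen_add ideal_gen_mult mult)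
  then show ?case by (simp add: lookup_mult_0 cst_mult algebra_simps)
qed

text \<open>Let \<open>x\<^sup>N = b g\<close> and \<open>g = a x\<close>.  The functional \<open>l h\<close>, the coefficient of \<open>\<Prod>x\<^sub>i\<^sup>N\<^sup>-\<^sup>1\<close> in \<open>det b h\<close>, kills
  the ideal by Cramer's rule, and it takes the value \<open>1\<close> at \<open>det a\<close> because \<open>(b a) x = x\<^sup>N\<close>.  In
  particular \<open>det a\<close> is not in the ideal.

  That the socle is no larger comes from the Bezoutian \<open>\<Delta>(x,y)\<close>, the determinant of a matrix \<open>\<theta>\<close> with
  \<open>g(x) - g(y) = \<theta> (x - y)\<close>.  For every \<open>p\<close> the element \<open>(p(x) - p(y)) \<Delta>\<close> lies in the ideal of the
  \<open>g\<^sub>i(x) - g\<^sub>i(y)\<close>, so applying \<open>l\<close> in \<open>x\<close> to \<open>p(x) \<Delta>\<close> and to \<open>p(y) \<Delta>\<close> gives the same class.  If \<open>p\<close> is in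
  the socle, only the constant terms of its cofactors matter: the first result is
  \<open>l p\<close> times \<open>\<Delta>(0,y)\<close> and the second is \<open>p\<close> times \<open>l (\<Delta>(x,0))\<close>.  The last factor is \<open>1\<close>, as
  \<open>\<Delta>(x,0)\<close> is again the determinant of a matrix that takes \<open>x\<close> to \<open>g\<close>.  So \<open>\<Delta>(0,y)\<close> spans the socle,
  and comparison with the socle element \<open>det a\<close> gives the claim.\<close>

theorem socle_functional:
  fixes g :: "'n::finite \<Rightarrow> 'n cpoly" and a :: "'n cpoly ^ 'n ^ 'n"
  assumes a: "\<And>i. (\<Sum>j\<in>UNIV. a $ i $ j * var j) = g i"
    and "N \<ge> 1" and pow: "\<And>i. var i ^ N \<in> ideal_gen g"
  shows "\<exists>l. linear_functional l \<and> (\<forall>p\<in>ideal_gen g. l p = 0) \<and> l (det a) = 1 \<and>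
    (\<forall>p. (\<forall>i. var i * p \<in> ideal_gen g) \<longrightarrow> p - cst (l p) * det a \<in> ideal_gen g)"
proof -
  let ?J = "ideal_gen g"
  let ?m = "const_exp (N - 1) :: 'n \<Rightarrow>\<^sub>0 nat"
  have "\<forall>i. \<exists>c. var i ^ N = (\<Sum>j\<in>UNIV. c j * g j)"
    using pow unfolding ideal_gen_def by blast
  from choice[OF this] obtain b' where b': "\<And>i. var i ^ N = (\<Sum>j\<in>UNIV. b' i j * g j)" by blast
  define b :: "'n cpoly ^ 'n ^ 'n" where "b = (\<chi> i j. b' i j)"
  define l where "l = (\<lambda>h. lookup (det b * h) ?m)"
  have l: "linear_functional l"
    unfolding linear_functional_def l_def
    by (simp add: distrib_left lookup_add mult.left_commute[of _ "cst _"])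
  have bg: "(b *v (\<chi> j. g j)) $ i = var i ^ N" for i
    by (simp add: b_def b' matrix_vector_mult_def)
  have l_J: "l p = 0" if "p \<in> ?J" for p
  proof -
    obtain c where p: "p = (\<Sum>j\<in>UNIV. c j * g j)" using \<open>p \<in> ?J\<close> unfolding ideal_gen_def by blast
    have "(\<chi> j. g j) $ j * det b \<in> box_ideal N UNIV" for j
      by (rule cramer_in_ideal[OF is_ideal_box_ideal]) (simp add: bg var_power_box_ideal)
    then have "(\<Sum>j\<in>UNIV. c j * (g j * det b)) \<in> box_ideal N UNIV"
      by (intro is_ideal_sum is_idealD(3)[OF is_ideal_box_ideal, of "g _ * det b"] is_ideal_box_ideal) simp
    also have "(\<Sum>j\<in>UNIV. c j * (g j * det b)) = det b * p"
      unfolding p sum_distrib_left by (rule sum.cong) (simp_all add: ac_simps)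
    finally show ?thesis
      using \<open>N \<ge> 1\<close> by (simp add: l_def box_ideal_def)
  qed
  \<comment> \<open>Stated for all such matrices, since it is also applied to the specialized Bezoutian matrix.\<close>
  have l_det: "l (det a') = 1" if a': "\<And>i. (\<Sum>j\<in>UNIV. a' $ i $ j * var j) = g i" for a' :: "'n cpoly ^ 'n ^ 'n"
  proof -
    have av: "a' *v (\<chi> j. var j) = (\<chi> j. g j)"
      using a' by (simp add: vec_eq_iff matrix_vector_mult_def)
    have "(\<Sum>j\<in>UNIV. (b ** a') $ i $ j * var j) = var i ^ N" for i
    proof -
      have "(\<Sum>j\<in>UNIV. (b ** a') $ i $ j * var j) = ((b ** a') *v (\<chi> j. var j)) $ i"
        by (simp add: matrix_vector_mult_def)
      also have "\<dots> = var i ^ N" by (simp only: matrix_vector_mul_assoc[symmetric] av bg)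
      finally show ?thesis .
    qed
    from det_coeff_corner[OF \<open>N \<ge> 1\<close> this] show ?thesis by (simp add: l_def det_mul)
  qed
  have det_socle: "var i * det a \<in> ?J" for i
  proof -
    have "(\<chi> j. var j) $ i * det a \<in> ?J"
      by (rule cramer_in_ideal[OF is_ideal_ideal_gen])
         (simp add: matrix_vector_mult_def a ideal_gen_base)
    then show ?thesis by simp
  qed
  have "\<forall>i. \<exists>c. in_x (g i) - in_y (g i) = (\<Sum>j\<in>UNIV. c j * (in_x (var j) - in_y (var j)))"
    using in_x_minus_in_y[of "g _"] unfolding ideal_gen_def by blast
  from choice[OF this] obtain th where th:
    "\<And>i. in_x (g i) - in_y (g i) = (\<Sum>j\<in>UNIV. th i j * (in_x (var j) - in_y (var j)))"
    by blast
  define Th where "Th = (\<chi> i j. th i j)"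
  define De where "De = det Th"
  have De_y0: "l (lookup De 0) = 1"
  proof -
    have "lookup De 0 = det (\<chi> i j. lookup (Th $ i $ j) 0)"
      unfolding De_def by (rule det_hom[of "\<lambda>P. lookup P 0"]) (simp_all add: lookup_add lookup_mult_0)
    also have "l \<dots> = 1"
    proof (rule l_det)
      fix i
      have v0: "lookup (var j :: 'n cpoly) 0 = 0" for j using lookup_var_mult[of j 1 0] by simp
      have g0: "lookup (g i) 0 = 0"
        unfolding a[symmetric] by (simp add: lookup_sum lookup_mult_0 v0)
      have "g i = lookup (in_x (g i) - in_y (g i)) 0"
        by (simp add: lookup_minus lookup_in_y g0 in_x_def)
      also have "\<dots> = (\<Sum>j\<in>UNIV. lookup (th i j) 0 * var j)"
        unfolding th by (simp add: lookup_sum lookup_mult_0 lookup_minus lookup_in_y v0 in_x_def)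
      finally show "(\<Sum>j\<in>UNIV. (\<chi> i j. lookup (Th $ i $ j) 0) $ i $ j * var j) = g i"
        by (simp add: Th_def)
    qed
    finally show ?thesis .
  qed
  define De0 where "De0 = Poly_Mapping.map (\<lambda>c. lookup c 0) De"
  have key: "cst (l p) * De0 - p \<in> ?J" if p: "\<And>i. var i * p \<in> ?J" for p
  proof -
    let ?I = "ideal_gen (\<lambda>i. in_x (g i) - in_y (g i))"
    have "apply_x l (in_x p * De) = cst (l p) * De0"
    proof (rule poly_mapping_eqI)
      fix t
      have "l (p * lookup De t - cst (lookup (lookup De t) 0) * p) = 0"
        using l_J socle_mult[OF p] by blast
      then have "l (p * lookup De t) = lookup (lookup De t) 0 * l p"
        by (simp add: linear_functionalD[OF l])
      then show "lookup (apply_x l (in_x p * De)) t = lookup (cst (l p) * De0) t"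
        by (simp add: lookup_apply_x[OF l] lookup_in_x_mult De0_def lookup_map_0)
    qed
    moreover have "apply_x l (in_y p * De) = p * apply_x l De"
      by (rule apply_x_in_y_mult[OF l])
    moreover have "p * apply_x l De - p \<in> ?J"
      using socle_mult[of p g "apply_x l De", OF p] by (simp add: lookup_apply_x[OF l] De_y0)
    moreover have "apply_x l ((in_x p - in_y p) * De) \<in> ?J"
    proof -
      obtain c where c: "in_x p - in_y p = (\<Sum>j\<in>UNIV. c j * (in_x (var j) - in_y (var j)))"
        using in_x_minus_in_y[of p] unfolding ideal_gen_def by blast
      have "(\<chi> j. in_x (var j) - in_y (var j)) $ j * De \<in> ?I" for j
        unfolding De_def
        by (rule cramer_in_ideal[OF is_ideal_ideal_gen])
           (simp add: matrix_vector_mult_def Th_def th[symmetric]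
             ideal_gen_base[of "\<lambda>i. in_x (g i) - in_y (g i)"])
      then have "(\<Sum>j\<in>UNIV. c j * ((in_x (var j) - in_y (var j)) * De)) \<in> ?I"
        by (intro ideal_gen_sum ideal_gen_mult[of "(in_x (var _) - in_y (var _)) * De"]) simp
      then have "(in_x p - in_y p) * De \<in> ?I"
        unfolding c by (simp add: sum_distrib_right mult.assoc)
      then obtain e where e: "(in_x p - in_y p) * De = (\<Sum>i\<in>UNIV. e i * (in_x (g i) - in_y (g i)))"
        unfolding ideal_gen_def by blast
      have "apply_x l (e i * (in_x (g i) - in_y (g i))) = - (apply_x l (e i) * g i)" for i
      proof -
        have "apply_x l (in_x (g i) * e i) = 0"
          by (rule poly_mapping_eqI)
             (simp add: lookup_apply_x[OF l] lookup_in_x_mult mult.commute[of "g i"] l_J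
               ideal_gen_mult ideal_gen_base)
        moreover have eq: "e i * (in_x (g i) - in_y (g i)) = in_x (g i) * e i - in_y (g i) * e i"
          by (simp add: algebra_simps)
        ultimately show ?thesis
          unfolding eq apply_x_diff[OF l] apply_x_in_y_mult[OF l] by (simp add: mult.commute)
      qed
      then have "apply_x l ((in_x p - in_y p) * De) = (\<Sum>i\<in>UNIV. - (apply_x l (e i) * g i))"
        unfolding e by (simp add: apply_x_sum[OF l])
      also have "\<dots> \<in> ?J"
        by (intro ideal_gen_sum ideal_gen_uminus ideal_gen_mult ideal_gen_base)
      finally show ?thesis .
    qed
    ultimately have "cst (l p) * De0 - p * apply_x l De \<in> ?J" "p * apply_x l De - p \<in> ?J"
      by (simp_all add: left_diff_distrib apply_x_diff[OF l])
    from ideal_gen_add[OF this] show ?thesis by simp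
  qed
  have "p - cst (l p) * det a \<in> ?J" if p: "\<And>i. var i * p \<in> ?J" for p
  proof -
    have "De0 - det a \<in> ?J" using key[OF det_socle] by (simp add: l_det[OF a])
    from ideal_gen_diff[OF ideal_gen_mult[OF this, of "cst (l p)"] key[OF p]]
    show ?thesis by (simp add: algebra_simps)
  qed
  then show ?thesis using l l_J l_det[OF a] by blast
qed

section \<open>The Milnor algebra in terms of polynomials\<close>

abbreviation jac :: "'n::finite cpoly \<Rightarrow> 'n cpoly set" where
  "jac f \<equiv> ideal_gen (\<lambda>i. pd i f)"

lemma ideal_of_is_ideal:
  fixes I :: "'a::comm_ring_1 set"
  assumes I: "is_ideal I"
  shows "ideal I ring_of_type_algebra"
proof -
  let ?R = "ring_of_type_algebra :: 'a ring"
  interpret R: cring ?R by (rule cring_from_type_algebra)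
  have inv: "\<ominus>\<^bsub>?R\<^esub> x = - x" for x
    by (rule R.minus_equality) (simp_all add: ring_of_type_algebra_def)
  show ?thesis
  proof (rule idealI)
    show "ring ?R" by (rule R.ring_axioms)
    show "subgroup I (add_monoid ?R)"
    proof (rule R.add.subgroupI)
      show "I \<noteq> {}" using is_idealD(1)[OF I] by blast
      show "\<And>a. a \<in> I \<Longrightarrow> \<ominus>\<^bsub>?R\<^esub> a \<in> I"
        unfolding inv using is_idealD(3)[OF I, of _ "- 1"] by simp
      show "\<And>a b. a \<in> I \<Longrightarrow> b \<in> I \<Longrightarrow> a \<oplus>\<^bsub>?R\<^esub> b \<in> I"
        using is_idealD(2)[OF I] by (simp add: ring_of_type_algebra_def)
    qed (simp add: ring_of_type_algebra_def)
    show "x \<otimes>\<^bsub>?R\<^esub> a \<in> I" if "a \<in> I" for a x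
      using is_idealD(3)[OF I that] by (simp add: ring_of_type_algebra_def)
    show "a \<otimes>\<^bsub>?R\<^esub> x \<in> I" if "a \<in> I" for a x
      using is_idealD(3)[OF I that, of x] by (simp add: ring_of_type_algebra_def mult.commute)
  qed
qed

lemma jacobian_ideal_eq: "jacobian_ideal f = jac f"
proof -
  let ?R = "ring_of_type_algebra :: 'a cpoly ring"
  interpret R: cring ?R by (rule cring_from_type_algebra)
  have sub: "{pd i f | i. True} \<subseteq> carrier ?R" by (simp add: ring_of_type_algebra_def)
  interpret J: ideal "jacobian_ideal f" ?R
    unfolding jacobian_ideal_def by (rule R.genideal_ideal[OF sub])
  show ?thesis
  proof
    show "jacobian_ideal f \<subseteq> jac f"
      unfolding jacobian_ideal_def
    proof (rule R.genideal_minimal)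
      show "ideal (jac f) ?R" by (rule ideal_of_is_ideal[OF is_ideal_ideal_gen])
      show "{pd i f | i. True} \<subseteq> jac f" using ideal_gen_base[of "\<lambda>i. pd i f"] by blast
    qed
    have closed: "is_ideal (jacobian_ideal f)"
      unfolding is_ideal_def
      using J.zero_closed J.a_closed J.I_l_closed by (simp add: ring_of_type_algebra_def)
    have base: "pd i f \<in> jacobian_ideal f" for i
      unfolding jacobian_ideal_def using R.genideal_self[OF sub] by blast
    show "jac f \<subseteq> jacobian_ideal f"
    proof
      fix p assume "p \<in> jac f"
      then obtain c where p: "p = (\<Sum>i\<in>UNIV. c i * pd i f)" unfolding ideal_gen_def by blast
      show "p \<in> jacobian_ideal f"
        unfolding p by (intro is_ideal_sum[OF closed] is_idealD(3)[OF closed base])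
    qed
  qed
qed

context
  fixes f :: "'n::finite cpoly"
begin

interpretation R: cring "ring_of_type_algebra :: 'n cpoly ring"
  by (rule cring_from_type_algebra)

interpretation J: ideal "jacobian_ideal f" "ring_of_type_algebra :: 'n cpoly ring"
  unfolding jacobian_ideal_eq by (rule ideal_of_is_ideal[OF is_ideal_ideal_gen])

interpretation M: cring "milnor_algebra f"
  unfolding milnor_algebra_def by (rule J.quotient_is_cring) (rule R.cring_axioms)

lemma milnor_class_eq_iff: "milnor_class f p = milnor_class f q \<longleftrightarrow> p - q \<in> jac f"
proof -
  have set: "milnor_class f p = {j + p | j. j \<in> jac f}" for p
    unfolding milnor_class_def a_r_coset_def' jacobian_ideal_eq
    by (auto simp: ring_of_type_algebra_def)
  show ?thesis
  proof
    assume "milnor_class f p = milnor_class f q"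
    moreover have "0 + p \<in> milnor_class f p" unfolding set using ideal_gen_0 by blast
    ultimately obtain j where "p = j + q" "j \<in> jac f" unfolding set by auto
    then show "p - q \<in> jac f" by simp
  next
    assume pq: "p - q \<in> jac f"
    have "j + p \<in> milnor_class f q" if "j \<in> jac f" for j
      unfolding set using ideal_gen_add[OF that pq]
      by (auto intro!: exI[of _ "j + (p - q)"])
    moreover have "j + q \<in> milnor_class f p" if "j \<in> jac f" for j
      unfolding set using ideal_gen_diff[OF that pq]
      by (auto intro!: exI[of _ "j - (p - q)"])
    ultimately show "milnor_class f p = milnor_class f q"
      unfolding set[of p] set[of q] by auto
  qed
qed

lemma milnor_class_mult: "milnor_class f p \<otimes>\<^bsub>milnor_algebra f\<^esub> milnor_class f q = milnor_class f (p * q)"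
  using ring_hom_mult[OF J.rcos_ring_hom, of p q]
  by (simp add: milnor_class_def milnor_algebra_def ring_of_type_algebra_def)

lemma milnor_class_add: "milnor_class f p \<oplus>\<^bsub>milnor_algebra f\<^esub> milnor_class f q = milnor_class f (p + q)"
  using ring_hom_add[OF J.rcos_ring_hom, of p q]
  by (simp add: milnor_class_def milnor_algebra_def ring_of_type_algebra_def)

lemma milnor_class_1: "\<one>\<^bsub>milnor_algebra f\<^esub> = milnor_class f 1"
  using ring_hom_one[OF J.rcos_ring_hom]
  by (simp add: milnor_class_def milnor_algebra_def ring_of_type_algebra_def)

lemma milnor_carrier: "carrier (milnor_algebra f) = range (milnor_class f)"
  by (auto simp: milnor_algebra_def milnor_class_def FactRing_def A_RCOSETS_def'
      ring_of_type_algebra_def)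

lemma milnor_class_0: "\<zero>\<^bsub>milnor_algebra f\<^esub> = milnor_class f 0"
proof -
  have "milnor_class f 0 \<oplus>\<^bsub>milnor_algebra f\<^esub> milnor_class f 0 = milnor_class f 0"
    by (simp add: milnor_class_add)
  then show ?thesis
    using M.add.r_cancel_one'[of "milnor_class f 0" "milnor_class f 0"] by (simp add: milnor_carrier)
qed

lemma milnor_class_power: "milnor_class f p [^]\<^bsub>milnor_algebra f\<^esub> (k::nat) = milnor_class f (p ^ k)"
  by (induction k) (simp_all add: milnor_class_1 milnor_class_mult mult.commute)

lemma milnor_scale_class: "milnor_scale f c (milnor_class f p) = milnor_class f (cst c * p)"
  by (simp add: milnor_scale_def milnor_class_mult)

lemma milnor_socle_eq: "milnor_socle f = milnor_class f ` {p. \<forall>i. var i * p \<in> jac f}"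
proof -
  have "milnor_socle f = {a \<in> range (milnor_class f).
      \<forall>i. milnor_class f (var i) \<otimes>\<^bsub>milnor_algebra f\<^esub> a = milnor_class f 0}"
    unfolding milnor_socle_def milnor_carrier milnor_class_0 ..
  also have "\<dots> = milnor_class f `
      {p. \<forall>i. milnor_class f (var i) \<otimes>\<^bsub>milnor_algebra f\<^esub> milnor_class f p = milnor_class f 0}"
    by blast
  finally show ?thesis
    unfolding milnor_class_mult milnor_class_eq_iff by simp
qed

end

section \<open>Gorenstein duality for the Milnor algebra\<close>

text \<open>On the socle of the Milnor algebra, \<open>l\<close> is the coordinate with respect to the class of the
  Hessian, that is \<open>\<omega>\<close>.  Unlike \<open>\<omega>\<close> it is defined on all polynomials, which lets linearity be used
  without tracking degrees.\<close>

definition socle_dual :: "'n::finite cpoly \<Rightarrow> ('n cpoly \<Rightarrow> complex) \<Rightarrow> bool" where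
  "socle_dual f l \<longleftrightarrow> linear_functional l \<and> (\<forall>p\<in>jac f. l p = 0) \<and> l (hessian f) = 1 \<and>
     (\<forall>p. (\<forall>i. var i * p \<in> jac f) \<longrightarrow> p - cst (l p) * hessian f \<in> jac f)"

lemma ideal_gen_scale:
  assumes "k \<noteq> 0"
  shows "ideal_gen (\<lambda>i. cst k * g i) = ideal_gen g"
proof
  show "ideal_gen (\<lambda>i. cst k * g i) \<subseteq> ideal_gen g"
  proof
    fix p assume "p \<in> ideal_gen (\<lambda>i. cst k * g i)"
    then obtain c where "p = (\<Sum>i\<in>UNIV. c i * (cst k * g i))" unfolding ideal_gen_def by blast
    then have "p = (\<Sum>i\<in>UNIV. (c i * cst k) * g i)" by (simp add: mult.assoc)
    then show "p \<in> ideal_gen g" by (rule ideal_genI)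
  qed
  show "ideal_gen g \<subseteq> ideal_gen (\<lambda>i. cst k * g i)"
  proof
    fix p assume "p \<in> ideal_gen g"
    then obtain c where "p = (\<Sum>i\<in>UNIV. c i * g i)" unfolding ideal_gen_def by blast
    moreover have "c i * g i = (c i * cst (1 / k)) * (cst k * g i)" for i
    proof -
      have "(c i * cst (1 / k)) * (cst k * g i) = c i * (cst (1 / k * k) * g i)"
        by (simp only: cst_mult ac_simps)
      then show ?thesis using assms by simp
    qed
    ultimately have "p = (\<Sum>i\<in>UNIV. (c i * cst (1 / k)) * (cst k * g i))" by simp
    then show "p \<in> ideal_gen (\<lambda>i. cst k * g i)" by (rule ideal_genI)
  qed
qed

lemma smooth_imp_powers_in_jac:
  fixes f :: "'n::finite cpoly"
  assumes f: "f \<in> forms d" and d: "d \<ge> 1" and smooth: "smooth_hypersurface f"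
  shows "\<exists>N\<ge>1. \<forall>i. var i ^ N \<in> jac f"
proof (rule power_in_ideal_gen)
  show "pd j f \<in> forms (d - 1)" for j using pd_forms[of f "d - 1"] f d by simp
  fix v :: "complex ^ 'n"
  assume v: "\<And>j. poly_eval (($) v) (pd j f) = 0"
  have "of_nat d * poly_eval (($) v) f = poly_eval (($) v) (\<Sum>i\<in>UNIV. var i * pd i f)"
    unfolding euler[OF f] by (simp add: poly_eval_mult)
  also have "\<dots> = 0" by (simp add: poly_eval_sum poly_eval_mult v)
  finally have "poly_eval (($) v) f = 0" using d by simp
  then show "v = 0" using smooth v unfolding smooth_hypersurface_def by blast
qed

text \<open>By Euler's formula the Hessian matrix takes the vector of variables to \<open>d - 1\<close> times the
  gradient, so the general result applies to these multiples as generators.\<close>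

theorem socle_dual_exists:
  fixes f :: "'n::finite cpoly"
  assumes f: "f \<in> forms d" and d: "d \<ge> 2" and smooth: "smooth_hypersurface f"
  shows "\<exists>l. socle_dual f l"
proof -
  let ?g = "\<lambda>i. cst (of_nat (d - 1)) * pd i f"
  let ?a = "\<chi> i j. pd i (pd j f)"
  have J: "ideal_gen ?g = jac f" using d by (intro ideal_gen_scale) simp
  obtain N where N: "N \<ge> 1" "\<And>i. var i ^ N \<in> jac f"
    using smooth_imp_powers_in_jac[OF f _ smooth] d by auto
  have "(\<Sum>j\<in>UNIV. ?a $ i $ j * var j) = ?g i" for i
  proof -
    have "pd i f \<in> forms (d - 1)" using pd_forms[of f "d - 1"] f d by simp
    from euler[OF this] show ?thesis by (simp add: pd_commute[of i] mult.commute)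
  qed
  from socle_functional[OF this N(1)] show ?thesis
    using N(2) unfolding J socle_dual_def hessian_def by blast
qed

lemma socle_dualD:
  assumes "socle_dual f l"
  shows "linear_functional l" "p \<in> jac f \<Longrightarrow> l p = 0" "l (hessian f) = 1"
    "(\<And>i. var i * p \<in> jac f) \<Longrightarrow> p - cst (l p) * hessian f \<in> jac f"
  using assms unfolding socle_dual_def by auto

lemma hessian_forms:
  fixes f :: "'n::finite cpoly"
  assumes "f \<in> forms d" "d \<ge> 2"
  shows "hessian f \<in> forms (CARD('n) * (d - 2))"
  unfolding hessian_def
proof (rule forms_det)
  fix i j
  have "f \<in> forms (Suc (Suc (d - 2)))" using assms by (simp add: Suc_diff_Suc numeral_2_eq_2)
  then show "(\<chi> i j. pd i (pd j f)) $ i $ j \<in> forms (d - 2)" by (simp add: pd_forms)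
qed

lemma single_in_ideal:
  assumes "var i ^ N \<in> ideal_gen g" "lookup t i \<ge> N"
  shows "single t c \<in> ideal_gen g"
proof -
  have "t = single i N + (t - single i N)"
    by (rule exp_le_add_diff) (use assms(2) in \<open>auto simp: lookup_single when_def\<close>)
  then have "single t c = single (t - single i N) c * var i ^ N"
    by (simp add: var_power mult_single add.commute)
  then show ?thesis using ideal_gen_mult[OF assms(1)] by simp
qed

lemma cpoly_in_ideal:
  assumes "\<And>t. t \<in> keys p \<Longrightarrow> single t (lookup p t) \<in> ideal_gen g"
  shows "p \<in> ideal_gen g"
  by (subst poly_mapping_expand) (rule ideal_gen_sum[OF assms])

lemma large_forms_in_ideal:
  fixes g :: "'n::finite \<Rightarrow> 'n cpoly"
  assumes pow: "\<And>i. var i ^ N \<in> ideal_gen g" and "N \<ge> 1" and m: "m \<ge> CARD('n) * N" and p: "p \<in> forms m"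
  shows "p \<in> ideal_gen g"
proof (rule cpoly_in_ideal)
  fix t assume "t \<in> keys p"
  then have t: "tdeg t = m" using p unfolding forms_iff by (auto simp: in_keys_iff)
  have "\<exists>i. lookup t i \<ge> N"
  proof (rule ccontr)
    assume "\<not> ?thesis"
    then have "tdeg t < (\<Sum>i\<in>(UNIV :: 'n set). N)"
      unfolding tdeg_def by (intro sum_strict_mono) (auto simp: not_le)
    then show False using t m by simp
  qed
  then obtain i where "lookup t i \<ge> N" by blast
  with pow[of i] show "single t (lookup p t) \<in> ideal_gen g" by (rule single_in_ideal)
qed

locale milnor_dual =
  fixes f :: "'n::finite cpoly" and d T :: nat and l :: "'n cpoly \<Rightarrow> complex"
  assumes f: "f \<in> forms d" and d: "d \<ge> 3" and smooth: "smooth_hypersurface f"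
    and T: "T = CARD('n) * (d - 2)" and dual: "socle_dual f l" and T3: "T \<ge> 3"
begin

lemmas lin = linear_functionalD[OF socle_dualD(1)[OF dual]]

lemma l_jac: "p \<in> jac f \<Longrightarrow> l p = 0"
  by (rule socle_dualD(2)[OF dual])

lemma l_cong: "p - q \<in> jac f \<Longrightarrow> l p = l q"
  using l_jac[of "p - q"] by (simp add: lin)

lemma pd_f_forms: "pd i f \<in> forms (d - 1)"
  using pd_forms[of f "d - 1"] f d by simp

text \<open>A socle element is congruent to a multiple of the Hessian, which has degree \<open>T\<close>; the component of
  degree \<open>m\<close> of this congruence is the claim.\<close>

lemma socle_degree:
  assumes "p \<in> forms m" "m \<noteq> T" "\<And>i. var i * p \<in> jac f"
  shows "p \<in> jac f"
proof -
  have "hcomp m (p - cst (l p) * hessian f) \<in> jac f"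
    by (rule ideal_gen_hcomp[OF pd_f_forms]) (rule socle_dualD(4)[OF dual assms(3)])
  moreover have "cst (l p) * hessian f \<in> forms T"
    unfolding T by (rule forms_cst_mult[OF hessian_forms[OF f]]) (use d in simp)
  ultimately show ?thesis
    using assms(1,2) by (simp add: hcomp_diff hcomp_of_form)
qed

text \<open>Downward induction on the degree, starting where every monomial contains a high power of a
  variable: if all forms of degree \<open>m + 1\<close> lie in the ideal, those of degree \<open>m\<close> are in the socle.\<close>

lemma forms_above_socle: "m > T \<Longrightarrow> p \<in> forms m \<Longrightarrow> p \<in> jac f"
proof -
  obtain N where N: "N \<ge> 1" "\<And>i. var i ^ N \<in> jac f"
    using smooth_imp_powers_in_jac[OF f _ smooth] d by auto
  show "m > T \<Longrightarrow> p \<in> forms m \<Longrightarrow> p \<in> jac f"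
  proof (induction "CARD('n) * N - m" arbitrary: m p rule: less_induct)
    case less
    show ?case
    proof (cases "m \<ge> CARD('n) * N")
      case True
      then show ?thesis using large_forms_in_ideal[OF N(2,1)] less.prems by blast
    next
      case False
      have "var i * p \<in> jac f" for i
        by (rule less.hyps[of "Suc m"]) (use False less.prems in \<open>auto intro: forms_var_mult\<close>)
      then show ?thesis using socle_degree less.prems by blast
    qed
  qed
qed

lemma socle_forms: "p \<in> forms T \<Longrightarrow> var i * p \<in> jac f"
  by (rule forms_above_socle[of "Suc T"]) (auto intro: forms_var_mult)

lemma top_form: "p \<in> forms T \<Longrightarrow> p \<in> jac f \<longleftrightarrow> l p = 0"
  using socle_dualD(4)[OF dual socle_forms, of p] l_jac[of p] by auto

lemma below_top_form:
  assumes "p \<in> forms (T - 1)"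
  shows "p \<in> jac f \<longleftrightarrow> (\<forall>i. l (var i * p) = 0)"
proof
  assume "p \<in> jac f"
  then show "\<forall>i. l (var i * p) = 0" using l_jac ideal_gen_mult by blast
next
  assume *: "\<forall>i. l (var i * p) = 0"
  have "var i * p \<in> forms T" for i using forms_var_mult[OF assms, of i] T3 by simp
  then have "var i * p \<in> jac f" for i using * top_form by blast
  then show "p \<in> jac f" using socle_degree[OF assms] T3 by auto
qed

text \<open>Multiplication by variables raises the degree until the pairing is \<open>l\<close> itself; on the way back,
  a form of degree below \<open>T\<close> whose multiples by the variables are in the ideal is in the ideal.\<close>

lemma pairing_nondegenerate:
  assumes "k \<le> T" "p \<in> forms k" "\<And>q. q \<in> forms (T - k) \<Longrightarrow> l (p * q) = 0"
  shows "p \<in> jac f"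
  using assms
proof (induction "T - k" arbitrary: k p)
  case 0
  then show ?case using top_form[of p] forms_1 by fastforce
next
  case (Suc j)
  have "var i * p \<in> jac f" for i
  proof (rule Suc.hyps(1)[of "Suc k"])
    fix q :: "'n cpoly"
    assume "q \<in> forms (T - Suc k)"
    then have "var i * q \<in> forms (T - k)"
      using forms_var_mult[of q "T - Suc k" i] Suc.hyps(2) by (simp add: Suc_diff_Suc)
    from Suc.prems(3)[OF this] show "l (var i * p * q) = 0" by (simp add: ac_simps)
  qed (use Suc.hyps(2) Suc.prems in \<open>auto intro: forms_var_mult\<close>)
  then show ?case using socle_degree[OF Suc.prems(2)] Suc.hyps(2) by auto
qed

lemma low_form_in_jac:
  assumes "p \<in> jac f" "p \<in> forms m" "m < d - 1"
  shows "p = 0"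
proof -
  obtain c where c: "p = (\<Sum>i\<in>UNIV. c i * pd i f)" using assms(1) unfolding ideal_gen_def by blast
  have "p = hcomp m p" using assms(2) by (simp add: hcomp_of_form)
  also have "\<dots> = 0"
    unfolding c hcomp_sum by (simp add: hcomp_mult_form(2)[OF pd_f_forms assms(3)])
  finally show ?thesis .
qed

section \<open>The associated form\<close>

lemma is_socle_iso_exists: "\<exists>w. is_socle_iso f w \<and> w (milnor_class f (hessian f)) = 1"
proof -
  define w where "w = (\<lambda>a. l (SOME p. a = milnor_class f p))"
  have w: "w (milnor_class f p) = l p" for p
  proof -
    have "milnor_class f p = milnor_class f (SOME q. milnor_class f p = milnor_class f q)"
      by (rule someI[of _ p]) simp
    then show ?thesis unfolding w_def milnor_class_eq_iff using l_cong by simp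
  qed
  have hess: "var i * hessian f \<in> jac f" for i
    by (rule socle_forms) (use hessian_forms[OF f] d T in simp)
  have "bij_betw w (milnor_socle f) UNIV"
    unfolding bij_betw_def
  proof
    show "inj_on w (milnor_socle f)"
    proof (rule inj_onI)
      fix a b assume "a \<in> milnor_socle f" "b \<in> milnor_socle f" and ab: "w a = w b"
      then obtain p q where p: "a = milnor_class f p" "\<And>i. var i * p \<in> jac f"
        and q: "b = milnor_class f q" "\<And>i. var i * q \<in> jac f"
        unfolding milnor_socle_eq by auto
      have "p - q \<in> jac f"
        using ideal_gen_diff[OF socle_dualD(4)[OF dual p(2)] socle_dualD(4)[OF dual q(2)]] ab
        by (simp add: w p(1) q(1))
      then show "a = b" using p q by (simp add: milnor_class_eq_iff)
    qed
    have "c \<in> w ` milnor_socle f" for c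
    proof (rule image_eqI)
      show "c = w (milnor_class f (cst c * hessian f))"
        by (simp add: w lin socle_dualD(3)[OF dual])
      have "var i * (cst c * hessian f) \<in> jac f" for i
        using ideal_gen_mult[OF hess, of "cst c" i] by (simp add: ac_simps)
      then show "milnor_class f (cst c * hessian f) \<in> milnor_socle f"
        unfolding milnor_socle_eq by blast
    qed
    then show "w ` milnor_socle f = UNIV" by blast
  qed
  moreover have "\<forall>a\<in>milnor_socle f. \<forall>b\<in>milnor_socle f. w (a \<oplus>\<^bsub>milnor_algebra f\<^esub> b) = w a + w b"
    unfolding milnor_socle_eq by (auto simp: milnor_class_add w lin)
  moreover have "\<forall>c. \<forall>a\<in>milnor_socle f. w (milnor_scale f c a) = c * w a"
    unfolding milnor_socle_eq by (auto simp: milnor_scale_class w lin)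
  ultimately show ?thesis
    unfolding is_socle_iso_def by (intro exI[of _ w]) (simp add: w socle_dualD(3)[OF dual])
qed

lemma socle_omega_class:
  assumes "p \<in> forms T"
  shows "socle_omega f (milnor_class f p) = l p"
proof -
  have iso: "is_socle_iso f (socle_omega f)" and one: "socle_omega f (milnor_class f (hessian f)) = 1"
    using someI_ex[OF is_socle_iso_exists] unfolding socle_omega_def by blast+
  have "hessian f \<in> forms T" using hessian_forms[OF f] d T by simp
  then have "milnor_class f (hessian f) \<in> milnor_socle f"
    unfolding milnor_socle_eq using socle_forms by blast
  moreover have "milnor_class f p = milnor_scale f (l p) (milnor_class f (hessian f))"
    unfolding milnor_scale_class milnor_class_eq_iff
    by (rule socle_dualD(4)[OF dual]) (rule socle_forms[OF assms])
  ultimately show ?thesis using iso one unfolding is_socle_iso_def by simp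
qed

end

lemma linear_form_forms: "linear_form y \<in> forms 1"
  unfolding linear_form_def by (intro forms_sum forms_cst_mult forms_var)

lemma linear_functional_mult: "linear_functional l \<Longrightarrow> linear_functional (\<lambda>p. l (q * p))"
  unfolding linear_functional_def by (simp add: distrib_left mult.left_commute[of _ "cst _"])

lemma linear_functional_linear_form:
  assumes l: "linear_functional l"
  shows "l (linear_form y * p) = (\<Sum>i\<in>UNIV. y $ i * l (var i * p))"
  unfolding linear_form_def sum_distrib_right mult.assoc
  by (simp add: linear_functionalD[OF l])

lemma pd_cst [simp]: "pd i (cst c) = 0"
  by (rule poly_mapping_eqI) (auto simp: lookup_pd cst_def lookup_single when_def poly_mapping_eq_iff fun_eq_iff lookup_add simp del: lookup_inject)

text \<open>The recursion is \<open>l (\<ell>\<^sup>k\<^sup>+\<^sup>1) = \<Sum>y\<^sub>i l (x\<^sub>i \<ell>\<^sup>k)\<close> for \<open>\<ell> = \<Sum>y\<^sub>i x\<^sub>i\<close>.  It uses the functionals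
  \<open>p \<mapsto> l (x\<^sub>i p)\<close>, so the induction ranges over all functionals.\<close>

lemma power_form_exists:
  fixes l :: "'n::finite cpoly \<Rightarrow> complex"
  assumes "linear_functional l"
  shows "\<exists>A\<in>forms k. (\<forall>y. poly_eval (($) y) A = l (linear_form y ^ k)) \<and>
    (\<forall>i y. poly_eval (($) y) (pd i A) = of_nat k * l (var i * linear_form y ^ (k - 1)))"
  using assms
proof (induction k arbitrary: l)
  case 0
  have "cst (l 1) \<in> forms 0" using forms_cst_mult[OF forms_1, of "l 1"] by simp
  then show ?case by (intro bexI[of _ "cst (l 1)"]) auto
next
  case (Suc k)
  let ?l = "\<lambda>i p. l (var i * p)"
  have "\<forall>i. \<exists>A. A \<in> forms k \<and> (\<forall>y. poly_eval (($) y) A = ?l i (linear_form y ^ k)) \<and>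
    (\<forall>j y. poly_eval (($) y) (pd j A) = of_nat k * ?l i (var j * linear_form y ^ (k - 1)))"
    using Suc.IH[OF linear_functional_mult[OF Suc.prems]] by blast
  from choice[OF this] obtain A where A: "\<And>i. A i \<in> forms k"
    "\<And>i y. poly_eval (($) y) (A i) = l (var i * linear_form y ^ k)"
    "\<And>i j y. poly_eval (($) y) (pd j (A i)) = of_nat k * l (var i * (var j * linear_form y ^ (k - 1)))"
    by blast
  let ?A = "\<Sum>i\<in>UNIV. var i * A i"
  have "?A \<in> forms (Suc k)" by (intro forms_sum forms_var_mult A)
  moreover have "poly_eval (($) y) ?A = l (linear_form y ^ Suc k)" for y
    by (simp add: poly_eval_sum poly_eval_mult A linear_functional_linear_form[OF Suc.prems])
  moreover have "poly_eval (($) y) (pd j ?A) = of_nat (Suc k) * l (var j * linear_form y ^ k)" for j y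
  proof -
    have "pd j ?A = A j + (\<Sum>i\<in>UNIV. var i * pd j (A i))"
      by (simp add: pd_sum pd_var_mult sum.distrib sum.delta)
    then have "poly_eval (($) y) (pd j ?A) = l (var j * linear_form y ^ k)
        + of_nat k * (\<Sum>i\<in>UNIV. y $ i * l (var i * (var j * linear_form y ^ (k - 1))))"
      by (simp add: poly_eval_add poly_eval_sum poly_eval_mult A sum_distrib_left mult.left_commute)
    also have "(\<Sum>i\<in>UNIV. y $ i * l (var i * (var j * linear_form y ^ (k - 1))))
        = l (linear_form y * (var j * linear_form y ^ (k - 1)))"
      by (rule linear_functional_linear_form[OF Suc.prems, symmetric])
    also have "of_nat k * l (linear_form y * (var j * linear_form y ^ (k - 1)))
        = of_nat k * l (var j * linear_form y ^ k)"
    proof (cases k)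
      case (Suc m)
      then show ?thesis by (simp add: mult.left_commute)
    qed simp
    finally show ?thesis by (simp add: algebra_simps)
  qed
  ultimately show ?case by (intro bexI[of _ ?A]) auto
qed

lemma pd_power_form:
  fixes A :: "'n::finite cpoly"
  assumes l: "linear_functional l" and A: "\<And>y. poly_eval (($) y) A = l (linear_form y ^ k)"
  shows "poly_eval (($) y) (pd i A) = of_nat k * l (var i * linear_form y ^ (k - 1))"
proof -
  obtain B where B: "\<And>y. poly_eval (($) y) B = l (linear_form y ^ k)"
    "\<And>i y. poly_eval (($) y) (pd i B) = of_nat k * l (var i * linear_form y ^ (k - 1))"
    using power_form_exists[OF l, of k] by blast
  have "A - B = 0" by (rule poly_eval_vec_eq_0_imp) (simp add: poly_eval_diff A B)
  then show ?thesis using B(2) by simp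
qed

lemma pd_pd_power_form:
  fixes A :: "'n::finite cpoly"
  assumes l: "linear_functional l" and A: "\<And>y. poly_eval (($) y) A = l (linear_form y ^ k)"
  shows "poly_eval (($) y) (pd j (pd i A))
    = of_nat (k * (k - 1)) * l (var i * (var j * linear_form y ^ (k - 2)))"
proof -
  let ?l = "\<lambda>p. l ((cst (of_nat k) * var i) * p)"
  have "poly_eval (($) y) (pd j (pd i A)) = of_nat (k - 1) * ?l (var j * linear_form y ^ (k - 1 - 1))"
    by (rule pd_power_form[OF linear_functional_mult[OF l]])
       (simp add: pd_power_form[OF l A] mult.assoc linear_functionalD[OF l])
  then show ?thesis by (simp add: mult.assoc linear_functionalD[OF l] numeral_2_eq_2)
qed

context milnor_dual
begin

lemma associated_form:
  shows associated_form_forms: "associated_form T f \<in> forms T"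
    and poly_eval_associated_form: "poly_eval (($) y) (associated_form T f) = l (linear_form y ^ T)"
proof -
  have omega: "socle_omega f (milnor_class f (linear_form y) [^]\<^bsub>milnor_algebra f\<^esub> T)
      = l (linear_form y ^ T)" for y
    unfolding milnor_class_power
    by (rule socle_omega_class) (use forms_power[OF linear_form_forms, of y T] in simp)
  obtain A where A: "A \<in> forms T" "\<And>y. poly_eval (($) y) A = l (linear_form y ^ T)"
    using power_form_exists[OF socle_dualD(1)[OF dual], of T] by blast
  have "associated_form T f = A"
    unfolding associated_form_def omega
  proof (rule the_equality)
    fix B assume B: "B \<in> forms T \<and> (\<forall>y. poly_eval (($) y) B = l (linear_form y ^ T))"
    have "B - A = 0" by (rule poly_eval_vec_eq_0_imp) (simp add: poly_eval_diff A B)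
    then show "B = A" by simp
  qed (use A in auto)
  then show "associated_form T f \<in> forms T"
    "poly_eval (($) y) (associated_form T f) = l (linear_form y ^ T)"
    using A by auto
qed

lemma linear_form_power_forms: "linear_form y ^ k \<in> forms k"
  using forms_power[OF linear_form_forms, of y k] by simp

text \<open>At \<open>y\<close> the partial derivatives of the associated form are \<open>T l (x\<^sub>i \<ell>\<^sup>T\<^sup>-\<^sup>1)\<close>.  They all vanish exactly
  when \<open>\<ell>\<^sup>T\<^sup>-\<^sup>1\<close> is in the socle, hence in the ideal, as its degree is not \<open>T\<close>.\<close>

lemma smooth_associated_form_iff:
  "smooth_hypersurface (associated_form T f) \<longleftrightarrow> (\<forall>y. y \<noteq> 0 \<longrightarrow> linear_form y ^ (T - 1) \<notin> jac f)"
proof -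
  let ?A = "associated_form T f"
  have pd: "poly_eval (($) y) (pd i ?A) = of_nat T * l (var i * linear_form y ^ (T - 1))" for i y
    by (rule pd_power_form[OF socle_dualD(1)[OF dual] poly_eval_associated_form])
  have grad: "linear_form y ^ (T - 1) \<in> jac f \<longleftrightarrow> (\<forall>i. poly_eval (($) y) (pd i ?A) = 0)" for y
    unfolding pd using below_top_form[OF linear_form_power_forms] T3 by auto
  have zero: "poly_eval (($) y) ?A = 0" if "linear_form y ^ (T - 1) \<in> jac f" for y
  proof -
    have "linear_form y ^ T = linear_form y * linear_form y ^ (T - 1)"
      using T3 by (simp flip: power_Suc)
    then show ?thesis
      using l_jac[OF ideal_gen_mult[OF that]] by (simp add: poly_eval_associated_form)
  qed
  show ?thesis unfolding smooth_hypersurface_def using grad zero by blast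
qed

end

lemma lookup_linear_form: "lookup (linear_form y) (unit_exp i) = y $ i"
proof -
  have "unit_exp j = unit_exp i \<longleftrightarrow> j = i" for j i :: 'a
    by (metis lookup_single_eq lookup_single_not_eq zero_neq_one)
  then show ?thesis
    by (simp add: linear_form_def lookup_sum var_def lookup_single when_def
        if_distrib[of "\<lambda>c. _ * c"] sum.delta cong: if_cong)
qed

lemma tdeg_eq_1: "tdeg t = 1 \<longleftrightarrow> (\<exists>i. t = unit_exp i)"
proof
  assume t: "tdeg t = 1"
  then obtain i where i: "lookup t i \<noteq> 0" unfolding tdeg_def by (metis sum.neutral zero_neq_one)
  have "t = unit_exp i + (t - unit_exp i)"
    using i by (rule exp_split_unit)
  moreover from this have "tdeg (t - unit_exp i) = 0"
    using t by (metis add_cancel_right_right tdeg_add tdeg_single)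
  ultimately show "\<exists>i. t = unit_exp i" by (metis add.right_neutral tdeg_eq_0)
qed auto

lemma forms_1_eq_linear_form:
  assumes "p \<in> forms 1"
  shows "p = linear_form (\<chi> i. lookup p (unit_exp i))"
proof (rule poly_mapping_eqI)
  fix t
  show "lookup p t = lookup (linear_form (\<chi> i. lookup p (unit_exp i))) t"
  proof (cases "tdeg t = 1")
    case True
    then obtain i where "t = unit_exp i" unfolding tdeg_eq_1 by blast
    then show ?thesis by (simp only: lookup_linear_form vec_lambda_beta)
  next
    case False
    then show ?thesis using assms linear_form_forms unfolding forms_iff by metis
  qed
qed

lemma linear_form_eq_0: "linear_form y = 0 \<longleftrightarrow> y = 0"
proof
  assume "linear_form y = 0"
  then have "y $ i = 0" for i using lookup_linear_form[of y i] by simp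
  then show "y = 0" by (simp add: vec_eq_iff)
qed (simp add: linear_form_def)

lemma cpoly_power_eq_0:
  fixes p :: "'v cpoly"
  assumes "p ^ k = 0"
  shows "p = 0"
proof (rule poly_eval_eq_0_imp)
  fix x
  have "poly_eval x p ^ k = 0" using assms by (simp flip: poly_eval_power)
  then show "poly_eval x p = 0" by simp
qed

lemma veronese_disjoint_iff:
  assumes I: "is_ideal I"
  shows "proj_space (I \<inter> forms m) \<inter> veronese m = {} \<longleftrightarrow> (\<forall>y. y \<noteq> 0 \<longrightarrow> linear_form y ^ m \<notin> I)"
proof
  assume empty: "proj_space (I \<inter> forms m) \<inter> veronese m = {}"
  show "\<forall>y. y \<noteq> 0 \<longrightarrow> linear_form y ^ m \<notin> I"
  proof (intro allI impI notI)
    fix y :: "complex ^ 'a"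
    assume y: "y \<noteq> 0" "linear_form y ^ m \<in> I"
    have lin: "linear_form y \<in> forms 1 - {0}" using y linear_form_forms linear_form_eq_0 by blast
    have "linear_form y ^ m \<in> forms m" using forms_power[OF linear_form_forms, of y m] by simp
    then have "linear_form y ^ m \<in> I \<inter> forms m - {0}"
      using y lin cpoly_power_eq_0 by blast
    then have "proj_point (linear_form y ^ m) \<in> proj_space (I \<inter> forms m)"
      unfolding proj_space_def by blast
    moreover have "proj_point (linear_form y ^ m) \<in> veronese m"
      unfolding veronese_def using lin by blast
    ultimately show False using empty by blast
  qed
next
  assume *: "\<forall>y. y \<noteq> 0 \<longrightarrow> linear_form y ^ m \<notin> I"
  show "proj_space (I \<inter> forms m) \<inter> veronese m = {}"
  proof (rule ccontr)
    assume "\<not> ?thesis"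
    then obtain p q where p: "p \<in> I" and q: "q \<in> forms 1" "q \<noteq> 0"
      and eq: "proj_point p = proj_point (q ^ m)"
      unfolding proj_space_def veronese_def by auto
    have "cst 1 * q ^ m \<in> proj_point (q ^ m)" unfolding proj_point_def by blast
    then obtain c where "q ^ m = cst c * p" unfolding eq[symmetric] unfolding proj_point_def by auto
    then have "q ^ m \<in> I" using is_idealD(3)[OF I p] by simp
    moreover have "q = linear_form (\<chi> i. lookup q (unit_exp i))"
      by (rule forms_1_eq_linear_form[OF q(1)])
    ultimately show False using * q(2) linear_form_eq_0 by metis
  qed
qed

section \<open>Zariski-open conditions\<close>

text \<open>With \<open>w\<close> the coefficient function of a form, these are the functions that cut out Zariski-closed
  sets.  Closure rules for functions replace the explicit polynomials in the coefficients.\<close>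

definition polyfun :: "(('v \<Rightarrow> complex) \<Rightarrow> complex) \<Rightarrow> bool" where
  "polyfun F \<longleftrightarrow> (\<exists>q. \<forall>w. poly_eval w q = F w)"

lemma polyfun_const: "polyfun (\<lambda>w. c)"
  unfolding polyfun_def by (intro exI[of _ "cst c"]) simp

lemma polyfun_coord: "polyfun (\<lambda>w. w i)"
  unfolding polyfun_def by (intro exI[of _ "var i"]) simp

lemma polyfun_add: "polyfun F \<Longrightarrow> polyfun G \<Longrightarrow> polyfun (\<lambda>w. F w + G w)"
  unfolding polyfun_def by (metis poly_eval_add)

lemma polyfun_mult: "polyfun F \<Longrightarrow> polyfun G \<Longrightarrow> polyfun (\<lambda>w. F w * G w)"
  unfolding polyfun_def by (metis poly_eval_mult)

lemma polyfun_diff: "polyfun F \<Longrightarrow> polyfun G \<Longrightarrow> polyfun (\<lambda>w. F w - G w)"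
  unfolding polyfun_def by (metis poly_eval_diff)

lemma polyfun_sum: "(\<And>a. a \<in> A \<Longrightarrow> polyfun (F a)) \<Longrightarrow> polyfun (\<lambda>w. \<Sum>a\<in>A. F a w)"
  by (induction A rule: infinite_finite_induct) (auto intro: polyfun_const polyfun_add)

lemma polyfun_prod: "(\<And>a. a \<in> A \<Longrightarrow> polyfun (F a)) \<Longrightarrow> polyfun (\<lambda>w. \<Prod>a\<in>A. F a w)"
  by (induction A rule: infinite_finite_induct) (auto intro: polyfun_const polyfun_mult)

lemma polyfun_power: "polyfun F \<Longrightarrow> polyfun (\<lambda>w. F w ^ k)"
  by (induction k) (auto intro: polyfun_const polyfun_mult)

lemma polyfun_if: "polyfun F \<Longrightarrow> polyfun G \<Longrightarrow> polyfun (\<lambda>w. if P then F w else G w)"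
  by (cases P) simp_all

lemma polyfun_poly_eval_comp:
  assumes "\<And>i. polyfun (\<lambda>w. G w i)"
  shows "polyfun (\<lambda>w. poly_eval (G w) p)"
  unfolding poly_eval_def
  by (intro polyfun_sum polyfun_mult polyfun_const polyfun_prod polyfun_power assms)

lemma generic_nonvanishing:
  assumes F: "polyfun F" and p0: "p0 \<in> forms m" "F (lookup p0) \<noteq> 0"
    and P: "\<And>p. p \<in> forms m \<Longrightarrow> F (lookup p) \<noteq> 0 \<Longrightarrow> P p"
  shows "generic m P"
proof -
  obtain q where q: "\<And>w. poly_eval w q = F w" using F unfolding polyfun_def by blast
  let ?U = "{p \<in> forms m. F (lookup p) \<noteq> 0}"
  have "forms m - ?U = {p \<in> forms m. \<forall>q'\<in>{q}. poly_eval (lookup p) q' = 0}"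
    using q by auto
  then have "zariski_open m ?U"
    unfolding zariski_open_def zariski_closed_def by blast
  then show ?thesis unfolding generic_def using p0 P by blast
qed

text \<open>Gaussian elimination without division, carried out with the pivots that work at \<open>w0\<close>.  The
  product of the pivots is a polynomial in \<open>w\<close>, and the elimination succeeds wherever it is not
  zero.\<close>

lemma surjective_open:
  fixes M :: "('v \<Rightarrow> complex) \<Rightarrow> 'r \<Rightarrow> 'c \<Rightarrow> complex"
  assumes "finite R" "finite C" and "\<And>r c. polyfun (\<lambda>w. M w r c)"
    and "\<And>b. \<exists>x. \<forall>r\<in>R. (\<Sum>c\<in>C. M w0 r c * x c) = b r"
  shows "\<exists>D. polyfun D \<and> D w0 \<noteq> 0 \<and>
    (\<forall>w. D w \<noteq> 0 \<longrightarrow> (\<forall>b. \<exists>x. \<forall>r\<in>R. (\<Sum>c\<in>C. M w r c * x c) = b r))"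
  using assms(1,3,4)
proof (induction R arbitrary: M rule: finite_induct)
  case empty
  then show ?case by (intro exI[of _ "\<lambda>_. 1"]) (simp add: polyfun_const)
next
  case (insert r0 R)
  obtain x where "(\<Sum>c\<in>C. M w0 r0 c * x c) = 1" using insert.prems(2)[of "\<lambda>_. 1"] by auto
  then obtain c0 where c0: "c0 \<in> C" "M w0 r0 c0 \<noteq> 0"
    by (metis (no_types, lifting) mult_zero_left sum.neutral zero_neq_one)
  define M' where "M' = (\<lambda>w r c. M w r0 c0 * M w r c - M w r c0 * M w r0 c)"
  have M'_sum: "(\<Sum>c\<in>C. M' w r c * x c)
      = M w r0 c0 * (\<Sum>c\<in>C. M w r c * x c) - M w r c0 * (\<Sum>c\<in>C. M w r0 c * x c)" for w r x
    unfolding M'_def sum_distrib_left sum_subtractf[symmetric]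
    by (rule sum.cong) (simp_all add: algebra_simps)
  have "polyfun (\<lambda>w. M' w r c)" for r c
    unfolding M'_def by (intro polyfun_diff polyfun_mult insert.prems)
  moreover have "\<exists>x. \<forall>r\<in>R. (\<Sum>c\<in>C. M' w0 r c * x c) = b r" for b
  proof -
    obtain x where x: "\<forall>r\<in>insert r0 R. (\<Sum>c\<in>C. M w0 r c * x c) = (if r = r0 then 0 else b r / M w0 r0 c0)"
      using insert.prems(2)[of "\<lambda>r. if r = r0 then 0 else b r / M w0 r0 c0"] by blast
    have "(\<Sum>c\<in>C. M' w0 r c * x c) = b r" if "r \<in> R" for r
    proof -
      have "r \<noteq> r0" using that insert.hyps by auto
      then show ?thesis using x that c0 by (simp add: M'_sum)
    qed
    then show ?thesis by blast
  qed
  ultimately obtain D where D: "polyfun D" "D w0 \<noteq> 0"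
    "\<And>w b. D w \<noteq> 0 \<Longrightarrow> \<exists>x. \<forall>r\<in>R. (\<Sum>c\<in>C. M' w r c * x c) = b r"
    using insert.IH[of M'] by blast
  have "\<exists>x. \<forall>r\<in>insert r0 R. (\<Sum>c\<in>C. M w r c * x c) = b r"
    if w: "M w r0 c0 * D w \<noteq> 0" for w b
  proof -
    have piv: "M w r0 c0 \<noteq> 0" using w by auto
    obtain x where x: "\<forall>r\<in>R. (\<Sum>c\<in>C. M' w r c * x c) = M w r0 c0 * b r - M w r c0 * b r0"
      using D(3)[of w "\<lambda>r. M w r0 c0 * b r - M w r c0 * b r0"] w by auto
    define e where "e = (b r0 - (\<Sum>c\<in>C. M w r0 c * x c)) / M w r0 c0"
    let ?y = "\<lambda>c. x c + (if c = c0 then e else 0)"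
    have y: "(\<Sum>c\<in>C. M w r c * ?y c) = (\<Sum>c\<in>C. M w r c * x c) + M w r c0 * e" for r
    proof -
      have "(\<Sum>c\<in>C. M w r c * ?y c) = (\<Sum>c\<in>C. M w r c * x c + (if c = c0 then M w r c0 * e else 0))"
        by (rule sum.cong) (auto simp: algebra_simps)
      then show ?thesis using assms(2) c0(1) by (simp add: sum.distrib)
    qed
    have r0: "(\<Sum>c\<in>C. M w r0 c * ?y c) = b r0"
      unfolding y using piv by (simp add: e_def)
    have "(\<Sum>c\<in>C. M w r c * ?y c) = b r" if "r \<in> R" for r
    proof -
      have "M w r0 c0 * (\<Sum>c\<in>C. M w r c * x c) - M w r c0 * (\<Sum>c\<in>C. M w r0 c * x c)
          = M w r0 c0 * b r - M w r c0 * b r0"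
        using x that unfolding M'_sum by blast
      then have "M w r0 c0 * ((\<Sum>c\<in>C. M w r c * x c) + M w r c0 * e) = M w r0 c0 * b r"
        unfolding e_def using piv by (simp add: field_simps)
      then show ?thesis unfolding y using piv by (metis mult_left_cancel)
    qed
    with r0 have "\<forall>r\<in>insert r0 R. (\<Sum>c\<in>C. M w r c * ?y c) = b r" by blast
    then show ?thesis by (intro exI[of _ ?y])
  qed
  moreover have "polyfun (\<lambda>w. M w r0 c0 * D w)"
    by (intro polyfun_mult insert.prems D)
  ultimately show ?case using c0 D(2) by (intro exI[of _ "\<lambda>w. M w r0 c0 * D w"]) auto
qed

lemma forms_eqI:
  assumes "p \<in> forms m" "q \<in> forms m" "\<And>t. tdeg t = m \<Longrightarrow> lookup p t = lookup q t"
  shows "p = q"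
proof (rule poly_mapping_eqI)
  fix t
  show "lookup p t = lookup q t"
    using assms by (cases "tdeg t = m") (simp_all add: forms_iff)
qed

text \<open>In degree \<open>m\<close> the ideal is spanned by the products \<open>x\<^sup>s \<partial>\<^sub>i f\<close>, whose coefficients are polynomials in
  those of \<open>f\<close>.  So it is an open condition on \<open>f\<close> that these products, together with fixed forms
  \<open>h\<^sub>i\<close>, span all forms of degree \<open>m\<close>.\<close>

lemma complement_of_jac_open:
  fixes h :: "'n::finite \<Rightarrow> 'n cpoly"
  assumes f0: "f0 \<in> forms d" and d: "d \<ge> 1" and m: "m \<ge> d - 1" and h: "\<And>i. h i \<in> forms m"
    and surj: "\<And>p. p \<in> forms m \<Longrightarrow> \<exists>c. p - (\<Sum>i\<in>UNIV. cst (c i) * h i) \<in> jac f0"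
  shows "\<exists>D. polyfun D \<and> D (lookup f0) \<noteq> 0 \<and>
    (\<forall>f\<in>forms d. D (lookup f) \<noteq> 0 \<longrightarrow>
       (\<forall>p\<in>forms m. \<exists>c. p - (\<Sum>i\<in>UNIV. cst (c i) * h i) \<in> jac f))"
proof -
  define k where "k = m - (d - 1)"
  define R where "R = {t :: 'n \<Rightarrow>\<^sub>0 nat. tdeg t = m}"
  define S where "S = {s :: 'n \<Rightarrow>\<^sub>0 nat. tdeg s = k}"
  define C where "C = (S \<times> (UNIV :: 'n set)) <+> (UNIV :: 'n set)"
  define M :: "(('n \<Rightarrow>\<^sub>0 nat) \<Rightarrow> complex) \<Rightarrow> ('n \<Rightarrow>\<^sub>0 nat) \<Rightarrow> (('n \<Rightarrow>\<^sub>0 nat) \<times> 'n) + 'n \<Rightarrow> complex" where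
    "M = (\<lambda>w r c. case c of
        Inl (s, i) \<Rightarrow> if \<forall>j. lookup s j \<le> lookup r j
                      then of_nat (lookup (r - s) i + 1) * w (r - s + unit_exp i) else 0
      | Inr i \<Rightarrow> lookup (h i) r)"
  have fin: "finite R" "finite S" "finite C"
    unfolding R_def S_def C_def by (auto intro!: finite_tdeg finite_Plus finite_cartesian_product)
  have M_Inl: "M (lookup f) r (Inl (s, i)) = lookup (single s 1 * pd i f) r" for f r s i
  proof (cases "\<forall>j. lookup s j \<le> lookup r j")
    case True
    then have "r = s + (r - s)" by (intro exp_le_add_diff) simp
    then have "lookup (single s 1 * pd i f) r = lookup (pd i f) (r - s)"
      using lookup_single_mult_add[of s 1 "pd i f" "r - s"] by simp
    then show ?thesis using True by (simp add: M_def lookup_pd)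
  next
    case False
    then obtain j where "lookup r j < lookup s j" by (auto simp: not_le)
    then have "lookup (single s 1 * pd i f) r = 0" by (rule lookup_single_mult_other)
    then show ?thesis by (simp only: M_def sum.case prod.case if_not_P[OF False])
  qed
  have M_sum: "(\<Sum>c\<in>C. M (lookup f) r c * x c)
      = lookup ((\<Sum>si\<in>S \<times> UNIV. cst (x (Inl si)) * (single (fst si) 1 * pd (snd si) f))
               + (\<Sum>i\<in>UNIV. cst (x (Inr i)) * h i)) r" for f r x
    unfolding C_def sum.Plus[OF finite_cartesian_product[OF fin(2) finite] finite] lookup_add lookup_sum
    by (intro arg_cong2[where f = "(+)"] sum.cong) (auto simp: M_Inl, simp add: M_def)
  have "\<exists>x. \<forall>r\<in>R. (\<Sum>c\<in>C. M (lookup f0) r c * x c) = b r" for b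
  proof -
    define p where "p = (\<Sum>r\<in>R. single r (b r))"
    have p: "p \<in> forms m"
      unfolding p_def by (intro forms_sum) (auto simp: R_def intro: forms_single)
    have lookup_p: "lookup p r = b r" if "r \<in> R" for r
      using that fin(1) by (simp add: p_def lookup_sum lookup_single when_def)
    obtain c where c: "p - (\<Sum>i\<in>UNIV. cst (c i) * h i) \<in> jac f0" using surj[OF p] by blast
    then obtain a where a: "p - (\<Sum>i\<in>UNIV. cst (c i) * h i) = (\<Sum>i\<in>UNIV. a i * pd i f0)"
      unfolding ideal_gen_def by blast
    have pdf: "pd i f0 \<in> forms (d - 1)" for i using pd_forms[of f0 "d - 1"] f0 d by simp
    have "p - (\<Sum>i\<in>UNIV. cst (c i) * h i) \<in> forms m"
      by (intro forms_diff p forms_sum forms_cst_mult h)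
    then have "p - (\<Sum>i\<in>UNIV. cst (c i) * h i) = hcomp m (\<Sum>i\<in>UNIV. a i * pd i f0)"
      using a hcomp_of_form[of _ m m] by metis
    also have "\<dots> = (\<Sum>i\<in>UNIV. hcomp k (a i) * pd i f0)"
      unfolding hcomp_sum using hcomp_mult_form(1)[OF pdf, of k] m by (simp add: k_def)
    also have "\<dots> = (\<Sum>i\<in>UNIV. \<Sum>s\<in>S. cst (lookup (a i) s) * (single s 1 * pd i f0))"
    proof (rule sum.cong[OF refl])
      fix i
      have "hcomp k (a i) = (\<Sum>s\<in>S. single s (lookup (a i) s))"
        using fin(2)
        by (intro poly_mapping_eqI) (simp add: lookup_hcomp lookup_sum lookup_single when_def S_def)
      also have "\<dots> = (\<Sum>s\<in>S. cst (lookup (a i) s) * single s 1)"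
        by (simp add: cst_def mult_single)
      finally show "hcomp k (a i) * pd i f0 = (\<Sum>s\<in>S. cst (lookup (a i) s) * (single s 1 * pd i f0))"
        by (simp add: sum_distrib_right mult.assoc)
    qed
    also have "\<dots> = (\<Sum>si\<in>S \<times> UNIV. cst (lookup (a (snd si)) (fst si)) * (single (fst si) 1 * pd (snd si) f0))"
      by (subst sum.swap) (simp add: sum.cartesian_product case_prod_beta)
    finally have "p = (\<Sum>si\<in>S \<times> UNIV. cst (lookup (a (snd si)) (fst si)) * (single (fst si) 1 * pd (snd si) f0))
        + (\<Sum>i\<in>UNIV. cst (c i) * h i)" by (simp add: algebra_simps)
    then have "\<forall>r\<in>R. (\<Sum>j\<in>C. M (lookup f0) r j * (case j of Inl si \<Rightarrow> lookup (a (snd si)) (fst si) | Inr i \<Rightarrow> c i)) = b r"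
      unfolding M_sum using lookup_p by simp
    then show ?thesis by blast
  qed
  moreover have "polyfun (\<lambda>w. M w r c)" for r c
  proof (cases c)
    case (Inl si)
    then show ?thesis
      unfolding M_def Inl sum.case case_prod_beta
      by (intro polyfun_if polyfun_const polyfun_mult polyfun_coord)
  next
    case (Inr i)
    then show ?thesis by (simp add: M_def polyfun_const)
  qed
  ultimately obtain D where D: "polyfun D" "D (lookup f0) \<noteq> 0"
    "\<And>w b. D w \<noteq> 0 \<Longrightarrow> \<exists>x. \<forall>r\<in>R. (\<Sum>c\<in>C. M w r c * x c) = b r"
    using surjective_open[OF fin(1,3), of M "lookup f0"] by blast
  have "\<exists>c. p - (\<Sum>i\<in>UNIV. cst (c i) * h i) \<in> jac f"
    if f: "f \<in> forms d" "D (lookup f) \<noteq> 0" and p: "p \<in> forms m" for f p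
  proof -
    obtain x where x: "\<forall>r\<in>R. (\<Sum>c\<in>C. M (lookup f) r c * x c) = lookup p r"
      using D(3)[OF f(2), of "lookup p"] by blast
    let ?q = "\<Sum>si\<in>S \<times> UNIV. cst (x (Inl si)) * (single (fst si) 1 * pd (snd si) f)"
    let ?r = "\<Sum>i\<in>UNIV. cst (x (Inr i)) * h i"
    have pdf: "pd i f \<in> forms (d - 1)" for i using pd_forms[of f "d - 1"] f(1) d by simp
    have "single s 1 * pd i f \<in> forms m" if "s \<in> S" for s i
    proof -
      have "tdeg s + (d - 1) = m" using that m by (simp add: S_def k_def)
      then show ?thesis using forms_mult[OF forms_single pdf] by metis
    qed
    then have "?q + ?r \<in> forms m"
      by (intro forms_add forms_sum forms_cst_mult h) auto
    moreover have "lookup p r = lookup (?q + ?r) r" if "tdeg r = m" for r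
    proof -
      have "r \<in> R" using that by (simp add: R_def)
      then show ?thesis using x unfolding M_sum by simp
    qed
    ultimately have "p = ?q + ?r" using p by (intro forms_eqI)
    then have "p - ?r = ?q" by simp
    also have "?q \<in> jac f"
      by (intro ideal_gen_sum ideal_gen_mult ideal_gen_base)
    finally show ?thesis by (intro exI[of _ "\<lambda>i. x (Inr i)"])
  qed
  with D(1,2) show ?thesis by blast
qed

section \<open>The strong Lefschetz property in degree one\<close>

lemma det_eq_0_kernel:
  fixes A :: "complex ^ 'n ^ 'n"
  shows "det A = 0 \<longleftrightarrow> (\<exists>z. z \<noteq> 0 \<and> A *v z = 0)"
  using matrix_left_invertible_ker[of A] invertible_det_nz[of A] invertible_left_inverse[of A] by blast

context milnor_dual
begin

definition hess_at :: "complex ^ 'n \<Rightarrow> complex ^ 'n ^ 'n" where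
  "hess_at y = (\<chi> i j. poly_eval (($) y) (pd i (pd j (associated_form T f))))"

lemma det_hess_at: "det (hess_at y) = poly_eval (($) y) (hessian (associated_form T f))"
  unfolding hessian_def hess_at_def by (subst poly_eval_det) simp

lemma hess_at_mult:
  "(hess_at y *v z) $ i = of_nat (T * (T - 1)) * l (var i * (linear_form z * linear_form y ^ (T - 2)))"
proof -
  have "(hess_at y *v z) $ i
      = (\<Sum>j\<in>UNIV. of_nat (T * (T - 1)) * (z $ j * l (var i * (var j * linear_form y ^ (T - 2)))))"
    unfolding matrix_vector_mult_def hess_at_def
    by (simp add: pd_pd_power_form[OF socle_dualD(1)[OF dual] poly_eval_associated_form] ac_simps)
  also have "\<dots> = of_nat (T * (T - 1)) * (\<Sum>j\<in>UNIV. z $ j * l (var i * (var j * linear_form y ^ (T - 2))))"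
    by (simp only: sum_distrib_left)
  also have "(\<Sum>j\<in>UNIV. z $ j * l (var i * (var j * linear_form y ^ (T - 2))))
      = l (var i * (linear_form z * linear_form y ^ (T - 2)))"
    by (rule linear_functional_linear_form[symmetric])
       (rule linear_functional_mult[OF socle_dualD(1)[OF dual]])
  finally show ?thesis .
qed

lemma T_factor: "(of_nat (T * (T - 1)) :: complex) \<noteq> 0"
  using T3 by simp

lemma linear_form_mult_power_forms: "linear_form z * linear_form y ^ (T - 2) \<in> forms (T - 1)"
proof -
  have "1 + (T - 2) = T - 1" using T3 by simp
  then show ?thesis using forms_mult[OF linear_form_forms linear_form_power_forms] by metis
qed

text \<open>The Hessian matrix of the associated form is, up to a factor, the matrix of the pairing
  \<open>(p, q) \<mapsto> l (p q \<ell>\<^sup>T\<^sup>-\<^sup>2)\<close> on linear forms.\<close>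

lemma hess_at_kernel: "hess_at y *v z = 0 \<longleftrightarrow> linear_form z * linear_form y ^ (T - 2) \<in> jac f"
  unfolding below_top_form[OF linear_form_mult_power_forms] vec_eq_iff hess_at_mult
  using T_factor by simp

lemma linear_form_in_jac: "linear_form z \<in> jac f \<Longrightarrow> z = 0"
  using low_form_in_jac[OF _ linear_form_forms] d linear_form_eq_0 by fastforce

text \<open>Injectivity and surjectivity are both read off from the Hessian matrix: a form of degree \<open>T - 1\<close> is
  determined modulo the ideal by its products with the variables, and for the products \<open>\<ell>\<^sup>T\<^sup>-\<^sup>2 q\<close> these
  are the entries of the matrix applied to the coefficients of \<open>q\<close>.\<close>

lemma multiplication_iso:
  assumes det: "det (hess_at y) \<noteq> 0"
  shows "is_milnor_linear_iso f (milnor_component f 1) (milnor_component f (T - 1))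
    (\<lambda>a. (milnor_class f (linear_form y) [^]\<^bsub>milnor_algebra f\<^esub> (T - 2)) \<otimes>\<^bsub>milnor_algebra f\<^esub> a)"
    (is "is_milnor_linear_iso f _ _ ?h")
proof -
  let ?L = "linear_form y ^ (T - 2)"
  have h: "?h (milnor_class f p) = milnor_class f (?L * p)" for p
    by (simp add: milnor_class_power milnor_class_mult)
  have "inj_on ?h (milnor_component f 1)"
  proof (rule inj_onI)
    fix a b
    assume "a \<in> milnor_component f 1" "b \<in> milnor_component f 1" and eq: "?h a = ?h b"
    then obtain p q where p: "a = milnor_class f p" "p \<in> forms 1" and q: "b = milnor_class f q" "q \<in> forms 1"
      unfolding milnor_component_def by auto
    obtain z where z: "p - q = linear_form z"
      using forms_1_eq_linear_form[OF forms_diff[OF p(2) q(2)]] by blast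
    have "?L * (p - q) \<in> jac f"
      using eq unfolding p(1) q(1) h milnor_class_eq_iff by (simp add: right_diff_distrib)
    then have "hess_at y *v z = 0" unfolding hess_at_kernel z by (simp add: mult.commute)
    then have "z = 0" using det det_eq_0_kernel by blast
    then have "p - q = 0" unfolding z using linear_form_eq_0[of z] by blast
    then show "a = b" using p q by simp
  qed
  moreover have "?h ` milnor_component f 1 = milnor_component f (T - 1)"
  proof
    show "?h ` milnor_component f 1 \<subseteq> milnor_component f (T - 1)"
    proof
      fix a assume "a \<in> ?h ` milnor_component f 1"
      then obtain p where p: "a = milnor_class f (?L * p)" "p \<in> forms 1"
        unfolding milnor_component_def using h by auto
      have "T - 2 + 1 = T - 1" using T3 by simp
      then have "?L * p \<in> forms (T - 1)" using forms_mult[OF linear_form_power_forms p(2)] by metis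
      then show "a \<in> milnor_component f (T - 1)" unfolding milnor_component_def p by blast
    qed
    show "milnor_component f (T - 1) \<subseteq> ?h ` milnor_component f 1"
    proof
      fix a assume "a \<in> milnor_component f (T - 1)"
      then obtain p where p: "a = milnor_class f p" "p \<in> forms (T - 1)"
        unfolding milnor_component_def by auto
      have "invertible (hess_at y)" using det invertible_det_nz by blast
      then have "bij ((*v) (hess_at y))" by (simp add: invertible_eq_bij)
      then obtain z where z: "hess_at y *v z = (\<chi> i. of_nat (T * (T - 1)) * l (var i * p))"
        using bij_is_surj unfolding surj_def by metis
      have "l (var i * (linear_form z * ?L)) = l (var i * p)" for i
        using hess_at_mult[of y z i] T_factor unfolding z by simp
      then have "linear_form z * ?L - p \<in> jac f"
        unfolding below_top_form[OF forms_diff[OF linear_form_mult_power_forms p(2)]]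
        by (simp add: right_diff_distrib lin)
      then have "a = ?h (milnor_class f (linear_form z))"
        unfolding h p(1) using ideal_gen_uminus milnor_class_eq_iff
        by (metis minus_diff_eq mult.commute)
      then show "a \<in> ?h ` milnor_component f 1"
        unfolding milnor_component_def using linear_form_forms by blast
    qed
  qed
  ultimately have "bij_betw ?h (milnor_component f 1) (milnor_component f (T - 1))"
    unfolding bij_betw_def by blast
  then show ?thesis
    unfolding is_milnor_linear_iso_def milnor_component_def
    by (auto simp: h milnor_class_add milnor_scale_class distrib_left mult.left_commute)
qed

lemma strong_lefschetz_of_hess_at:
  assumes "det (hess_at y) \<noteq> 0"
  shows "strong_lefschetz_in_degree T f 1"
  unfolding strong_lefschetz_in_degree_def
proof (rule generic_nonvanishing)
  let ?F = "\<lambda>w :: ('n \<Rightarrow>\<^sub>0 nat) \<Rightarrow> complex.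
    poly_eval (\<lambda>i. w (unit_exp i)) (hessian (associated_form T f))"
  show "polyfun ?F" by (intro polyfun_poly_eval_comp polyfun_coord)
  show "linear_form y \<in> forms 1" by (rule linear_form_forms)
  have "(\<lambda>i. lookup (linear_form y) (unit_exp i)) = ($) y"
    unfolding lookup_linear_form by simp
  then show "?F (lookup (linear_form y)) \<noteq> 0" using assms by (simp only: det_hess_at not_False_eq_True)
  fix p :: "'n cpoly"
  assume p: "p \<in> forms 1" "?F (lookup p) \<noteq> 0"
  let ?y = "\<chi> i. lookup p (unit_exp i)"
  have "($) ?y = (\<lambda>i. lookup p (unit_exp i))" by (simp add: fun_eq_iff)
  then have "det (hess_at ?y) \<noteq> 0" using p(2) by (simp only: det_hess_at not_False_eq_True)
  from multiplication_iso[OF this]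
  show "is_milnor_linear_iso f (milnor_component f 1) (milnor_component f (T - 1))
    (\<lambda>a. (milnor_class f p [^]\<^bsub>milnor_algebra f\<^esub> (T - 2 * 1)) \<otimes>\<^bsub>milnor_algebra f\<^esub> a)"
    unfolding forms_1_eq_linear_form[OF p(1), symmetric] by simp
qed

text \<open>Gorenstein duality for the associated form instead of \<open>f\<close>: the Hessian of a smooth form is not in
  its Jacobian ideal, in particular it is not zero.\<close>

lemma strong_lefschetz_of_smooth:
  assumes "smooth_hypersurface (associated_form T f)"
  shows "strong_lefschetz_in_degree T f 1"
proof -
  obtain l' where "socle_dual (associated_form T f) l'"
    using socle_dual_exists[OF associated_form_forms _ assms] T3 by auto
  then have "hessian (associated_form T f) \<noteq> 0"
    using socle_dualD(3) linear_functionalD(3)[OF socle_dualD(1)] by fastforce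
  then obtain y where "poly_eval (($) y) (hessian (associated_form T f)) \<noteq> 0"
    using poly_eval_vec_eq_0_imp by blast
  then show ?thesis using strong_lefschetz_of_hess_at det_hess_at by metis
qed

text \<open>If \<open>\<ell>\<^sub>z \<ell>\<^sup>T\<^sup>-\<^sup>2\<close> were in the ideal for some \<open>z \<noteq> 0\<close>, \<open>\<ell>\<^sub>z\<close> would be orthogonal to the image of the multiplication map,
  hence to all forms of degree \<open>T - 1\<close>, and nondegeneracy of the pairing would put \<open>\<ell>\<^sub>z\<close> in the ideal,
  which has no non-zero elements of degree one.\<close>

lemma hess_at_of_surjective:
  assumes surj: "\<And>p. p \<in> forms (T - 1) \<Longrightarrow> \<exists>w. p - linear_form w * linear_form y ^ (T - 2) \<in> jac f"
  shows "det (hess_at y) \<noteq> 0"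
proof
  assume "det (hess_at y) = 0"
  then obtain z where z: "z \<noteq> 0" "hess_at y *v z = 0" using det_eq_0_kernel by blast
  then have zL: "linear_form z * linear_form y ^ (T - 2) \<in> jac f" by (simp add: hess_at_kernel)
  have "l (linear_form z * p) = 0" if p: "p \<in> forms (T - 1)" for p
  proof -
    obtain w where w: "p - linear_form w * linear_form y ^ (T - 2) \<in> jac f" using surj[OF p] by blast
    have "linear_form z * (p - linear_form w * linear_form y ^ (T - 2))
        + linear_form w * (linear_form z * linear_form y ^ (T - 2)) \<in> jac f"
      by (intro ideal_gen_add ideal_gen_mult w zL)
    then show ?thesis using l_jac by (simp add: algebra_simps)
  qed
  then have "linear_form z \<in> jac f"
    using pairing_nondegenerate[of 1 "linear_form z"] T3 linear_form_forms[of z] by simp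
  then show False using linear_form_in_jac z(1) by blast
qed

end

section \<open>The Fermat form\<close>

abbreviation fermat :: "nat \<Rightarrow> 'n::finite cpoly" where
  "fermat d \<equiv> \<Sum>i\<in>UNIV. var i ^ d"

lemma fermat_forms: "fermat d \<in> forms d"
proof (rule forms_sum)
  fix i
  show "var i ^ d \<in> forms d" using forms_power[OF forms_var, of i d] by simp
qed

lemma pd_var_power: "pd i (var j ^ k) = (if j = i then cst (of_nat k) * var j ^ (k - 1) else 0)"
proof (induction k)
  case 0
  then show ?case using pd_cst[of i 1] by simp
next
  case (Suc k)
  show ?case
  proof (cases "j = i")
    case True
    have "pd i (var i ^ Suc k) = var i ^ k + cst (of_nat k) * (var i * var i ^ (k - 1))"
      using Suc True by (simp add: pd_var_mult mult.left_commute)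
    also have "cst (of_nat k) * (var i * var i ^ (k - 1)) = cst (of_nat k) * var i ^ k"
      by (cases k) simp_all
    also have "var i ^ k + cst (of_nat k) * var i ^ k = cst (of_nat (Suc k)) * var i ^ k"
      by (simp add: cst_add distrib_right)
    finally show ?thesis using True by simp
  qed (use Suc in \<open>simp add: pd_var_mult\<close>)
qed

lemma power_in_jac_fermat:
  assumes "d \<ge> 1"
  shows "var i ^ (d - 1) \<in> jac (fermat d)"
proof -
  have "pd i (fermat d) = cst (of_nat d) * var i ^ (d - 1)"
    by (simp add: pd_sum pd_var_power)
  then have "cst (1 / of_nat d) * (cst (of_nat d) * var i ^ (d - 1)) \<in> jac (fermat d)"
    using ideal_gen_mult[OF ideal_gen_base, of "cst (1 / of_nat d)" "\<lambda>i. pd i (fermat d)" i] by simp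
  also have "cst (1 / of_nat d) * (cst (of_nat d) * var i ^ (d - 1)) = cst (1 / of_nat d * of_nat d) * var i ^ (d - 1)"
    by (simp only: cst_mult mult.assoc)
  finally show ?thesis using assms by simp
qed

text \<open>For \<open>k = d - 2\<close> these are the exponents of the monomials of degree \<open>T - 1\<close> outside the Jacobian
  ideal of the Fermat form, \<open>(x\<^sub>1\<dots>x\<^sub>n)\<^sup>k / x\<^sub>j\<close>.\<close>

lemma exponents_below_corner:
  fixes t :: "'n::finite \<Rightarrow>\<^sub>0 nat"
  assumes "\<And>i. lookup t i \<le> k" "tdeg t + 1 = CARD('n) * k"
  shows "\<exists>j. t + unit_exp j = const_exp k"
proof -
  let ?u = "const_exp k - t :: 'n \<Rightarrow>\<^sub>0 nat"
  have u: "const_exp k = t + ?u" by (rule exp_le_add_diff) (simp add: assms(1))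
  have "tdeg (const_exp k :: 'n \<Rightarrow>\<^sub>0 nat) = CARD('n) * k" by (simp add: tdeg_def)
  then have "tdeg ?u = 1" using assms(2) arg_cong[OF u, of tdeg] by simp
  then obtain j where "?u = unit_exp j" unfolding tdeg_eq_1 by blast
  then show ?thesis using u by metis
qed

abbreviation all_ones :: "complex ^ 'n" where "all_ones \<equiv> \<chi> i. 1"

text \<open>The denominator of a multinomial coefficient.\<close>

definition exp_fact :: "('n::finite \<Rightarrow>\<^sub>0 nat) \<Rightarrow> complex" where
  "exp_fact t = (\<Prod>i\<in>UNIV. fact (lookup t i))"

lemma exp_fact_add_unit: "exp_fact (t + unit_exp i) = of_nat (lookup t i + 1) * exp_fact t"
proof -
  have "exp_fact (t + unit_exp i) = fact (lookup t i + 1) * (\<Prod>j\<in>UNIV - {i}. fact (lookup (t + unit_exp i) j))"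
    unfolding exp_fact_def by (subst prod.remove[of UNIV i]) (simp_all add: lookup_add)
  also have "(\<Prod>j\<in>UNIV - {i}. fact (lookup (t + unit_exp i) j)) = (\<Prod>j\<in>UNIV - {i}. fact (lookup t j) :: complex)"
    by (rule prod.cong) (auto simp: lookup_add lookup_single when_def)
  also have "fact (lookup t i + 1) * (\<Prod>j\<in>UNIV - {i}. fact (lookup t j))
      = of_nat (lookup t i + 1) * (fact (lookup t i) * (\<Prod>j\<in>UNIV - {i}. fact (lookup t j) :: complex))"
    by simp
  also have "fact (lookup t i) * (\<Prod>j\<in>UNIV - {i}. fact (lookup t j)) = exp_fact t"
    unfolding exp_fact_def by (rule prod.remove[symmetric]) simp_all
  finally show ?thesis .
qed

lemma exp_fact_var_mult:
  "exp_fact t * lookup (var i * p) t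
    = (if lookup t i = 0 then 0 else of_nat (lookup t i) * (exp_fact (t - unit_exp i) * lookup p (t - unit_exp i)))"
proof (cases "lookup t i = 0")
  case False
  have "t = unit_exp i + (t - unit_exp i)"
    using False by (rule exp_split_unit)
  then have "exp_fact t = exp_fact (t - unit_exp i + unit_exp i)" by (simp add: add.commute)
  also have "\<dots> = of_nat (lookup t i) * exp_fact (t - unit_exp i)"
    unfolding exp_fact_add_unit using False by (simp add: lookup_minus del: of_nat_Suc of_nat_add)
  finally show ?thesis using False by (simp add: lookup_var_mult)
qed (simp add: lookup_var_mult)

lemma exp_fact_var_mult_const:
  assumes q: "\<And>s. tdeg s = k \<Longrightarrow> exp_fact s * lookup q s = c" and t: "tdeg t = Suc k"
  shows "exp_fact t * lookup (var i * q) t = of_nat (lookup t i) * c"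
proof (cases "lookup t i = 0")
  case False
  have "t = unit_exp i + (t - unit_exp i)"
    using False by (rule exp_split_unit)
  then have "tdeg t = 1 + tdeg (t - unit_exp i)" by (metis tdeg_add tdeg_single)
  then show ?thesis using False t by (simp add: exp_fact_var_mult q)
qed (simp add: exp_fact_var_mult)

lemma multinomial_coefficient:
  fixes t :: "'n::finite \<Rightarrow>\<^sub>0 nat"
  assumes "tdeg t = k"
  shows "exp_fact t * lookup (linear_form all_ones ^ k) t = fact k"
  using assms
proof (induction k arbitrary: t)
  case 0
  then have "t = 0" by simp
  then show ?case by (simp add: exp_fact_def)
next
  case (Suc k)
  let ?L = "linear_form (all_ones :: complex ^ 'n)"
  have "?L * ?L ^ k = (\<Sum>i\<in>UNIV. var i * ?L ^ k)"
    unfolding linear_form_def sum_distrib_right by simp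
  then have "exp_fact t * lookup (?L ^ Suc k) t = (\<Sum>i\<in>UNIV. exp_fact t * lookup (var i * ?L ^ k) t)"
    by (simp add: lookup_sum sum_distrib_left)
  also have "\<dots> = (\<Sum>i\<in>UNIV. of_nat (lookup t i) * fact k)"
    by (intro sum.cong refl exp_fact_var_mult_const[OF Suc.IH Suc.prems])
  also have "\<dots> = of_nat (tdeg t) * fact k"
    by (simp add: tdeg_def sum_distrib_right)
  also have "\<dots> = fact (Suc k)" using Suc.prems by simp
  finally show ?case .
qed

text \<open>Put \<open>k = d - 2\<close>.  By the multinomial formula the coefficient of \<open>(x\<^sub>1\<dots>x\<^sub>n)\<^sup>k / x\<^sub>j\<close> in
  \<open>(x\<^sub>1 + \<dots> + x\<^sub>n)\<^sup>T\<^sup>-\<^sup>2 x\<^sub>i\<close> is a non-zero constant times \<open>k - \<delta>\<^sub>i\<^sub>j\<close>.  The matrix \<open>(k - \<delta>\<^sub>i\<^sub>j)\<close> has eigenvalues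
  \<open>n k - 1\<close> and \<open>- 1\<close>; the solution \<open>w\<close> below is its inverse applied to \<open>b\<close>, written in terms of the
  sum \<open>s\<close> of the entries of \<open>w\<close>.\<close>

lemma fermat_surjective:
  fixes p :: "'n::finite cpoly"
  assumes d: "d \<ge> 3" and T: "T = CARD('n) * (d - 2)" and T3: "T \<ge> 3" and p: "p \<in> forms (T - 1)"
  shows "\<exists>w. p - linear_form w * linear_form all_ones ^ (T - 2) \<in> jac (fermat d)"
proof -
  define k where "k = d - 2"
  define L where "L = linear_form (all_ones :: complex ^ 'n)"
  define W where "W = (\<lambda>t :: 'n \<Rightarrow>\<^sub>0 nat. fact (T - 2) / exp_fact t)"
  have nz: "exp_fact t \<noteq> 0" for t :: "'n \<Rightarrow>\<^sub>0 nat" by (simp add: exp_fact_def)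
  have coeff: "lookup (linear_form w * L ^ (T - 2)) t = W t * (\<Sum>i\<in>UNIV. w $ i * of_nat (lookup t i))"
    if t: "tdeg t = T - 1" for t w
  proof -
    have one: "exp_fact t * lookup (var i * L ^ (T - 2)) t = of_nat (lookup t i) * fact (T - 2)" for i
      unfolding L_def
      by (rule exp_fact_var_mult_const[OF multinomial_coefficient]) (use t T3 in auto)
    then have "lookup (var i * L ^ (T - 2)) t = W t * of_nat (lookup t i)" for i
      using one[of i] nz[of t] by (simp add: W_def field_simps)
    then show ?thesis
      unfolding linear_form_def sum_distrib_right lookup_sum sum_distrib_left mult.assoc lookup_cst_mult
      by (intro sum.cong) (simp_all add: ac_simps)
  qed
  let ?t = "\<lambda>j. const_exp k - unit_exp j :: 'n \<Rightarrow>\<^sub>0 nat"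
  define b where "b = (\<lambda>j. lookup p (?t j) / W (?t j))"
  define s where "s = (\<Sum>j\<in>UNIV. b j) / (of_nat T - 1)"
  define w where "w = (\<chi> j. of_nat k * s - b j)"
  have T1: "of_nat T - 1 \<noteq> (0 :: complex)"
  proof -
    have "of_nat T \<noteq> (of_nat 1 :: complex)" using T3 by (simp only: of_nat_eq_iff)
    then show ?thesis by simp
  qed
  have sum_w: "(\<Sum>i\<in>UNIV. w $ i) = s"
  proof -
    have "(\<Sum>i\<in>UNIV. w $ i) = of_nat T * s - (\<Sum>j\<in>UNIV. b j)"
      by (simp add: w_def sum_subtractf T k_def)
    also have "(\<Sum>j\<in>UNIV. b j) = s * (of_nat T - 1)" using T1 by (simp add: s_def)
    finally show ?thesis by (simp add: algebra_simps)
  qed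
  have "p - linear_form w * L ^ (T - 2) \<in> jac (fermat d)"
  proof (rule cpoly_in_ideal)
    fix t assume t: "t \<in> keys (p - linear_form w * L ^ (T - 2))"
    have "1 + (T - 2) = T - 1" using T3 by simp
    then have "linear_form w * L ^ (T - 2) \<in> forms (T - 1)"
      unfolding L_def
      using forms_mult[OF linear_form_forms forms_power[OF linear_form_forms, of _ "T - 2"]] by (metis mult_1_right)
    then have "p - linear_form w * L ^ (T - 2) \<in> forms (T - 1)" using p by (rule forms_diff[rotated])
    then have tdeg: "tdeg t = T - 1" using t unfolding forms_iff by (auto simp: in_keys_iff)
    have "\<exists>i. lookup t i \<ge> d - 1"
    proof (rule ccontr)
      assume *: "\<not> ?thesis"
      have "lookup t i \<le> k" for i
      proof -
        have "\<not> lookup t i \<ge> d - 1" using * by blast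
        then show ?thesis using d unfolding k_def by linarith
      qed
      moreover have "tdeg t + 1 = CARD('n) * k" using tdeg T T3 by (simp add: k_def)
      ultimately obtain j where j: "t + unit_exp j = const_exp k" using exponents_below_corner by blast
      then have tj: "t = ?t j" by (metis add_diff_cancel_right')
      have "(\<Sum>i\<in>UNIV. w $ i * of_nat (lookup t i)) = (\<Sum>i\<in>UNIV. of_nat k * w $ i - (if i = j then w $ j else 0))"
      proof (rule sum.cong[OF refl])
        fix i
        have "lookup (t + unit_exp j) i = k" unfolding j by simp
        then have "lookup t i + (if i = j then 1 else 0) = k"
          by (simp add: lookup_add lookup_single when_def eq_commute split: if_splits)
        then have "(of_nat (lookup t i) :: complex) = of_nat k - (if i = j then 1 else 0)"
          by (auto split: if_splits)
        then have "w $ i * of_nat (lookup t i) = w $ i * (of_nat k - (if i = j then 1 else 0))"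
          by (rule arg_cong)
        then show "w $ i * of_nat (lookup t i) = of_nat k * w $ i - (if i = j then w $ j else 0)"
          by (cases "i = j") (simp_all add: algebra_simps)
      qed
      also have "\<dots> = of_nat k * s - w $ j"
        by (simp add: sum_subtractf sum_distrib_left[symmetric] sum_w)
      also have "\<dots> = b j" by (simp add: w_def)
      also have "\<dots> = lookup p t / W t" unfolding b_def tj[symmetric] ..
      finally have "lookup (linear_form w * L ^ (T - 2)) t = lookup p t"
        unfolding coeff[OF tdeg] using nz by (simp add: W_def)
      then show False using t by (simp add: in_keys_iff lookup_minus)
    qed
    then obtain i where "lookup t i \<ge> d - 1" by blast
    moreover have "var i ^ (d - 1) \<in> jac (fermat d)" using power_in_jac_fermat[of d i] d by simp
    ultimately show "single t (lookup (p - linear_form w * L ^ (T - 2)) t) \<in> jac (fermat d)"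
      by (intro single_in_ideal)
  qed
  then show ?thesis unfolding L_def by blast
qed

lemma forms_in_jac_fermat:
  fixes p :: "'n::finite cpoly"
  assumes d: "d \<ge> 3" and p: "p \<in> forms (CARD('n) * (d - 2) + 1)"
  shows "p \<in> jac (fermat d)"
proof (rule cpoly_in_ideal)
  fix t assume "t \<in> keys p"
  then have t: "tdeg t = CARD('n) * (d - 2) + 1" using p unfolding forms_iff by (auto simp: in_keys_iff)
  have "\<exists>i. lookup t i \<ge> d - 1"
  proof (rule ccontr)
    assume *: "\<not> ?thesis"
    have "lookup t i \<le> d - 2" for i
    proof -
      have "\<not> lookup t i \<ge> d - 1" using * by blast
      then show ?thesis using d by linarith
    qed
    then have "tdeg t \<le> (\<Sum>i\<in>(UNIV :: 'n set). d - 2)" unfolding tdeg_def by (intro sum_mono)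
    then show False using t by simp
  qed
  then obtain i where "lookup t i \<ge> d - 1" by blast
  moreover have "var i ^ (d - 1) \<in> jac (fermat d)" using power_in_jac_fermat[of d i] d by simp
  ultimately show "single t (lookup p t) \<in> jac (fermat d)" by (intro single_in_ideal)
qed

section \<open>Generic forms\<close>

lemma smooth_of_forms_in_jac:
  fixes f :: "'n::finite cpoly"
  assumes "\<And>p. p \<in> forms m \<Longrightarrow> p \<in> jac f"
  shows "smooth_hypersurface f"
  unfolding smooth_hypersurface_def
proof (intro allI impI, rule ccontr)
  fix v :: "complex ^ 'n"
  assume v: "v \<noteq> 0 \<and> poly_eval (($) v) f = 0" and "\<nexists>i. poly_eval (($) v) (pd i f) \<noteq> 0"
  then have pd: "poly_eval (($) v) (pd i f) = 0" for i by blast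
  have "v $ i = 0" for i
  proof -
    have "var i ^ m \<in> forms m" using forms_power[OF forms_var, of i m] by simp
    then have "var i ^ m \<in> jac f" by (rule assms)
    then obtain c where "var i ^ m = (\<Sum>i\<in>UNIV. c i * pd i f)" unfolding ideal_gen_def by blast
    then have "poly_eval (($) v) (var i ^ m) = 0" by (simp add: poly_eval_sum poly_eval_mult pd)
    then show ?thesis by (simp add: poly_eval_power)
  qed
  then show False using v by (simp add: vec_eq_iff)
qed

lemma socle_degree_ge_3:
  assumes "CARD('n::finite) \<ge> 3" "d \<ge> 3" "T = CARD('n) * (d - 2)"
  shows "T \<ge> 3" and "T - 1 \<ge> d - 1"
proof -
  have "3 * (d - 2) \<le> T" unfolding assms(3) by (intro mult_right_mono assms) simp
  then show "T \<ge> 3" "T - 1 \<ge> d - 1" using assms(2) by linarith+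
qed

text \<open>The associated form of the Fermat form, a multiple of \<open>(x\<^sub>1\<dots>x\<^sub>n)\<^sup>d\<^sup>-\<^sup>2\<close>, is not smooth, but the
  multiplication by \<open>(x\<^sub>1 + \<dots> + x\<^sub>n)\<^sup>T\<^sup>-\<^sup>2\<close> is still surjective.  Smoothness, in the form that all forms of
  degree \<open>T + 1\<close> lie in the Jacobian ideal, and this surjectivity are both open conditions that
  hold at the Fermat form, and together they imply the strong Lefschetz property.\<close>

lemma generic_strong_lefschetz:
  assumes n: "CARD('n::finite) \<ge> 3" and d: "d \<ge> 3" and T: "T = CARD('n) * (d - 2)"
  shows "generic d (\<lambda>f :: 'n cpoly. strong_lefschetz_in_degree T f 1)"
proof -
  note T3 = socle_degree_ge_3[OF n d T]
  let ?L = "linear_form (all_ones :: complex ^ 'n)"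
  let ?f0 = "fermat d :: 'n cpoly"
  have sum: "(\<Sum>i\<in>UNIV. cst (c i) * (var i * ?L ^ (T - 2))) = linear_form (\<chi> i. c i) * ?L ^ (T - 2)" for c
    by (simp add: linear_form_def sum_distrib_right mult.assoc)
  have "\<exists>D. polyfun D \<and> D (lookup ?f0) \<noteq> 0 \<and> (\<forall>f\<in>forms d. D (lookup f) \<noteq> 0 \<longrightarrow>
      (\<forall>p\<in>forms (T + 1). \<exists>c. p - (\<Sum>i\<in>UNIV. cst (c i) * (\<lambda>_ :: 'n. 0) i) \<in> jac f))"
  proof (rule complement_of_jac_open[OF fermat_forms])
    show "\<exists>c. p - (\<Sum>i\<in>UNIV. cst (c i) * (\<lambda>_ :: 'n. 0) i) \<in> jac ?f0" if "p \<in> forms (T + 1)" for p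
      using forms_in_jac_fermat[OF d, of p] that by (simp add: T)
  qed (use T3 d in auto)
  then obtain D1 where D1: "polyfun D1" "D1 (lookup ?f0) \<noteq> 0"
    "\<And>f p. f \<in> forms d \<Longrightarrow> D1 (lookup f) \<noteq> 0 \<Longrightarrow> p \<in> forms (T + 1) \<Longrightarrow> p \<in> jac f" by auto
  have "\<exists>D. polyfun D \<and> D (lookup ?f0) \<noteq> 0 \<and> (\<forall>f\<in>forms d. D (lookup f) \<noteq> 0 \<longrightarrow>
      (\<forall>p\<in>forms (T - 1). \<exists>c. p - (\<Sum>i\<in>UNIV. cst (c i) * (var i * ?L ^ (T - 2))) \<in> jac f))"
  proof (rule complement_of_jac_open[OF fermat_forms])
    show "\<exists>c. p - (\<Sum>i\<in>UNIV. cst (c i) * (var i * ?L ^ (T - 2))) \<in> jac ?f0" if p: "p \<in> forms (T - 1)" for p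
    proof -
      obtain w where "p - linear_form w * ?L ^ (T - 2) \<in> jac ?f0"
        using fermat_surjective[OF d T T3(1) p] by blast
      then show ?thesis unfolding sum by (intro exI[of _ "($) w"]) simp
    qed
    have "Suc (T - 2) = T - 1" using T3 by simp
    moreover have "var i * ?L ^ (T - 2) \<in> forms (Suc (T - 2))" for i
      using forms_var_mult[OF forms_power[OF linear_form_forms, of _ "T - 2"]] by simp
    ultimately show "var i * ?L ^ (T - 2) \<in> forms (T - 1)" for i by simp
  qed (use T3 d in auto)
  then obtain D2 where D2: "polyfun D2" "D2 (lookup ?f0) \<noteq> 0"
    "\<And>f p. f \<in> forms d \<Longrightarrow> D2 (lookup f) \<noteq> 0 \<Longrightarrow> p \<in> forms (T - 1) \<Longrightarrow>
      \<exists>w. p - linear_form w * ?L ^ (T - 2) \<in> jac f" unfolding sum by blast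
  show ?thesis
  proof (rule generic_nonvanishing)
    show "polyfun (\<lambda>w. D1 w * D2 w)" by (intro polyfun_mult D1 D2)
    show "?f0 \<in> forms d" by (rule fermat_forms)
    show "D1 (lookup ?f0) * D2 (lookup ?f0) \<noteq> 0" using D1 D2 by simp
    fix f :: "'n cpoly"
    assume f: "f \<in> forms d" "D1 (lookup f) * D2 (lookup f) \<noteq> 0"
    then have D: "D1 (lookup f) \<noteq> 0" "D2 (lookup f) \<noteq> 0" by auto
    have smooth: "smooth_hypersurface f" using D1(3)[OF f(1) D(1)] by (rule smooth_of_forms_in_jac)
    obtain l where "socle_dual f l" using socle_dual_exists[OF f(1) _ smooth] d by auto
    then interpret milnor_dual f d T l by unfold_locales (use f d smooth T T3 in auto)
    have "det (hess_at all_ones) \<noteq> 0" using D2(3)[OF f(1) D(2)] by (rule hess_at_of_surjective)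
    then show "strong_lefschetz_in_degree T f 1" by (rule strong_lefschetz_of_hess_at)
  qed
qed

theorem corollary1p6:
  fixes d T :: nat
  assumes "CARD('n::finite) \<ge> 3" and "d \<ge> 3" and "T = CARD('n) * (d - 2)"
  shows
    "(\<forall>f \<in> (forms d :: 'n cpoly set). smooth_hypersurface f \<longrightarrow>
        (smooth_hypersurface (associated_form T f) \<longleftrightarrow>
           proj_space (jacobian_ideal f \<inter> forms (T - 1)) \<inter> veronese (T - 1) = {}) \<and>
        (smooth_hypersurface (associated_form T f) \<longrightarrow> strong_lefschetz_in_degree T f 1)) \<and>
     generic d (\<lambda>f :: 'n cpoly. strong_lefschetz_in_degree T f 1)"
proof (intro conjI ballI impI)
  fix f :: "'n cpoly"
  assume f: "f \<in> forms d" and smooth: "smooth_hypersurface f"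
  obtain l where "socle_dual f l" using socle_dual_exists[OF f _ smooth] assms(2) by auto
  then interpret milnor_dual f d T l
    by unfold_locales (use f smooth assms socle_degree_ge_3[OF assms] in auto)
  show "smooth_hypersurface (associated_form T f) \<longleftrightarrow>
      proj_space (jacobian_ideal f \<inter> forms (T - 1)) \<inter> veronese (T - 1) = {}"
    unfolding jacobian_ideal_eq veronese_disjoint_iff[OF is_ideal_ideal_gen]
    by (rule smooth_associated_form_iff)
  assume "smooth_hypersurface (associated_form T f)"
  then show "strong_lefschetz_in_degree T f 1" by (rule strong_lefschetz_of_smooth)
qed (rule generic_strong_lefschetz[OF assms])

end
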